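(* Let $d\ge2$, let $U\subset\mathbb{R}^d$ be a bounded open set, and let $A$, $B$, $c$ satisfy assumption (A) of the context with ellipticity constant $\lambda>0$. Let $\alpha\in(0,\infty)$, $g\in L^1(U)$, $G\in L^2(U,\mathbb{R}^d)$ and $v\in H^{1,2}_0(U)$. Assume that $v$ is a weak solution to $$-\mathrm{div}(A\nabla v)+\langle B,\nabla v\rangle+(c+\alpha)v=g-\mathrm{div}G\ \text{ in }U,\qquad v=0\ \text{ on }\partial U.$$ Then $$\|v\|_{L^1(U)}\le\alpha^{-1}\|g\|_{L^1(U)}+|U|^{1/2}C_1\|G\|_{L^2(U)},$$ where $C_1>0$ is the energy constant described in the context.
   Context: $\langle\cdot,\cdot\rangle$ and $\|\cdot\|$ are the Euclidean inner product and norm; $|U|$ is the Lebesgue measure of $U$; $\|F\|_{L^p(U)}:=\big\|\,\|F\|\,\big\|_{L^p(U)}$ for vector fields. $H^{1,2}(U)$ is the Sobolev space with norm $\big(\|f\|_{L^2(U)}^2+\sum_i\|\partial_i f\|_{L^2(U)}^2\big)^{1/2}$, and $H^{1,2}_0(U)$ is the closure of $C_0^\infty(U)$ (smooth functions compactly supported in $U$) in it, with the same norm. Exponent: $2_*:=\frac{2d}{d+2}$ if $d\ge3$; if $d=2$, $2_*\in(1,2)$ is arbitrary but fixed once and for all. Assumption (A): $U$ is a bounded open subset of $\mathbb{R}^d$, $d\ge2$; $A=(a_{ij})$ is a (possibly non-symmetric) $d\times d$ matrix of functions in $L^\infty(U)$ such that for some constants $\lambda,\Lambda>0$, $\langle A(x)\xi,\xi\rangle\ge\lambda\|\xi\|^2$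 and $\max_{i,j}|a_{ij}(x)|\le\Lambda$ for all $x\in U$, $\xi\in\mathbb{R}^d$; $B\in L^2(U,\mathbb{R}^d)$ satisfies $\mathrm{div}B\le0$ weakly, i.e. $\int_U\langle B,\nabla\varphi\rangle dx\ge0$ for all $\varphi\in C_0^\infty(U)$ with $\varphi\ge0$; $c\in L^{2_*}(U)$ with $c\ge0$. Weak solution: $v$ is a weak solution to the Dirichlet problem $-\mathrm{div}(A\nabla v)+\langle B,\nabla v\rangle+(c+\alpha)v=g-\mathrm{div}G$ in $U$, $v=0$ on $\partial U$, if $v\in H^{1,2}_0(U)$ and for any $\varphi\in C_0^\infty(U)$, $\int_U\langle A\nabla v,\nabla\varphi\rangle+(\langle B,\nabla v\rangle+(c+\alpha)v)\varphi\,dx=\int_Ug\varphi+\langle G,\nabla\varphi\rangle dx$, where both integrals are well defined in $\mathbb{R}$. Energy constant: $C_1>0$ is a constant depending only on $\lambda,d,|U|$ (for the fixed $2_*$) such that for all coefficients $A',B',c'$ satisfying (A) on $U$ with the same ellipticity constant $\lambda$, all $\alpha'\in[0,\infty)$, $f'\in L^{2_*}(U)$ and $F'\in L^2(U,\mathbb{R}^d)$, the unique weak solution $u'$ of the corresponding Dirichlet problem $-\mathrm{div}(A'\nabla u')+\langle B',\nabla u'\rangle+(c'+\alpha')u'=f'-\mathrm{div}F'$ in $U$, $u'=0$ on $\partial U$, satisfies $\|u'\|_{H^{1,2}_0(U)}\le C_1(\|f'\|_{L^{2_*}(U)}+\|F'\|_{L^2(U)})$. *)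

theory Defs
  imports "HOL-Analysis.Analysis"
begin

text \<open>
  Throughout, the ambient space is \<open>real ^ 'n\<close>, so that \<open>d = CARD('n)\<close>. A function on a set \<open>U\<close>
  is a total function of which only the values on \<open>U\<close> matter; elements of Lebesgue and Sobolev
  spaces are represented by functions, not by classes modulo equality almost everywhere.
\<close>

definition grad :: "(real ^ 'n \<Rightarrow> real) \<Rightarrow> real ^ 'n \<Rightarrow> real ^ 'n" where
  "grad f x = (\<chi> i. frechet_derivative f (at x) (axis i 1))"

primrec Ck :: "nat \<Rightarrow> (real ^ 'n \<Rightarrow> real) \<Rightarrow> bool" where
  "Ck 0 f \<longleftrightarrow> continuous_on UNIV f"
| "Ck (Suc k) f \<longleftrightarrow> (\<forall>x. f differentiable (at x)) \<and> (\<forall>i. Ck k (\<lambda>x. grad f x $ i))"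

text \<open>An element of \<open>C\<^sub>0\<^sup>\<infinity>(U)\<close> is identified with its extension by zero to the whole space.\<close>

definition test_functions :: "(real ^ 'n) set \<Rightarrow> (real ^ 'n \<Rightarrow> real) set" where
  "test_functions U = {\<phi>. (\<forall>k. Ck k \<phi>) \<and> compact (closure {x. \<phi> x \<noteq> 0}) \<and> closure {x. \<phi> x \<noteq> 0} \<subseteq> U}"

text \<open>Used for finite exponents \<open>p \<ge> 1\<close> only.\<close>

definition in_Lp :: "real \<Rightarrow> (real ^ 'n) set \<Rightarrow> (real ^ 'n \<Rightarrow> 'b::euclidean_space) \<Rightarrow> bool" where
  "in_Lp p U f \<longleftrightarrow> f \<in> borel_measurable (lebesgue_on U) \<and>
     integrable (lebesgue_on U) (\<lambda>x. norm (f x) powr p)"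

definition Lp_norm :: "real \<Rightarrow> (real ^ 'n) set \<Rightarrow> (real ^ 'n \<Rightarrow> 'b::euclidean_space) \<Rightarrow> real" where
  "Lp_norm p U f = (\<integral>x. norm (f x) powr p \<partial>lebesgue_on U) powr (1 / p)"

definition locally_integrable :: "(real ^ 'n) set \<Rightarrow> (real ^ 'n \<Rightarrow> 'b::euclidean_space) \<Rightarrow> bool" where
  "locally_integrable U f \<longleftrightarrow> (\<forall>K. compact K \<and> K \<subseteq> U \<longrightarrow> integrable (lebesgue_on K) f)"

definition has_weak_grad ::
  "(real ^ 'n) set \<Rightarrow> (real ^ 'n \<Rightarrow> real) \<Rightarrow> (real ^ 'n \<Rightarrow> real ^ 'n) \<Rightarrow> bool" where
  "has_weak_grad U u Du \<longleftrightarrow> locally_integrable U u \<and> locally_integrable U Du \<and>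
     (\<forall>\<phi>\<in>test_functions U. \<forall>i.
        (\<integral>x. u x * grad \<phi> x $ i \<partial>lebesgue_on U) = - (\<integral>x. Du x $ i * \<phi> x \<partial>lebesgue_on U))"

text \<open>Weak gradients are unique up to null sets on open sets; an arbitrary version is chosen.\<close>

definition weak_grad :: "(real ^ 'n) set \<Rightarrow> (real ^ 'n \<Rightarrow> real) \<Rightarrow> real ^ 'n \<Rightarrow> real ^ 'n" where
  "weak_grad U u = (SOME Du. has_weak_grad U u Du)"

definition H12 :: "(real ^ 'n) set \<Rightarrow> (real ^ 'n \<Rightarrow> real) set" where
  "H12 U = {u. in_Lp 2 U u \<and> (\<exists>Du. has_weak_grad U u Du \<and> in_Lp 2 U Du)}"

definition H12_norm :: "(real ^ 'n) set \<Rightarrow> (real ^ 'n \<Rightarrow> real) \<Rightarrow> real" where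
  "H12_norm U u = sqrt ((Lp_norm 2 U u)\<^sup>2 + (\<Sum>i\<in>UNIV. (Lp_norm 2 U (\<lambda>x. weak_grad U u x $ i))\<^sup>2))"

definition H12_0 :: "(real ^ 'n) set \<Rightarrow> (real ^ 'n \<Rightarrow> real) set" where
  "H12_0 U = {u \<in> H12 U. \<forall>\<epsilon>>0. \<exists>\<phi>\<in>test_functions U. H12_norm U (\<lambda>x. u x - \<phi> x) < \<epsilon>}"

text \<open>
  \<open>is_two_star d p\<close>: \<open>p\<close> is an admissible value of \<open>2\<^sub>*\<close> in dimension \<open>d \<ge> 2\<close>. For \<open>d = 2\<close> every
  \<open>p\<close> in the open interval from 1 to 2 is admissible.
\<close>

definition is_two_star :: "nat \<Rightarrow> real \<Rightarrow> bool" where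
  "is_two_star d p \<longleftrightarrow>
     (d \<ge> 3 \<and> p = 2 * real d / (real d + 2)) \<or> (d = 2 \<and> 1 < p \<and> p < 2)"

definition weak_div_nonpos :: "(real ^ 'n) set \<Rightarrow> (real ^ 'n \<Rightarrow> real ^ 'n) \<Rightarrow> bool" where
  "weak_div_nonpos U B \<longleftrightarrow>
     (\<forall>\<phi>\<in>test_functions U. (\<forall>x\<in>U. \<phi> x \<ge> 0) \<longrightarrow> (\<integral>x. B x \<bullet> grad \<phi> x \<partial>lebesgue_on U) \<ge> 0)"

text \<open>
  Assumption (A) with ellipticity constant \<open>lam\<close>, where \<open>p\<close> is the fixed value of \<open>2\<^sub>*\<close>. Measurability
  of the entries of \<open>A\<close> and the pointwise bound \<open>Lam\<close> together give \<open>a\<^sub>i\<^sub>j \<in> L\<^sup>\<infinity>(U)\<close>.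
\<close>

definition assumption_A ::
  "real \<Rightarrow> (real ^ 'n) set \<Rightarrow> real \<Rightarrow> (real ^ 'n \<Rightarrow> real ^ 'n ^ 'n) \<Rightarrow> (real ^ 'n \<Rightarrow> real ^ 'n)
    \<Rightarrow> (real ^ 'n \<Rightarrow> real) \<Rightarrow> bool" where
  "assumption_A p U lam A B c \<longleftrightarrow>
     CARD('n) \<ge> 2 \<and> bounded U \<and> open U \<and>
     (\<forall>i j. (\<lambda>x. A x $ i $ j) \<in> borel_measurable (lebesgue_on U)) \<and>
     lam > 0 \<and> (\<forall>x\<in>U. \<forall>\<xi>. (A x *v \<xi>) \<bullet> \<xi> \<ge> lam * (norm \<xi>)\<^sup>2) \<and>
     (\<exists>Lam>0. \<forall>x\<in>U. \<forall>i j. \<bar>A x $ i $ j\<bar> \<le> Lam) \<and>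
     in_Lp 2 U B \<and> weak_div_nonpos U B \<and>
     in_Lp p U c \<and> (AE x in lebesgue_on U. c x \<ge> 0)"

text \<open>
  Weak solutions of \<open>- div (A \<nabla>v) + \<langle>B, \<nabla>v\<rangle> + (c + \<alpha>) v = g - div G\<close> in \<open>U\<close> with \<open>v = 0\<close> on the boundary.
  Well-definedness of both integrals is part of the notion.
\<close>

definition is_weak_solution ::
  "(real ^ 'n) set \<Rightarrow> (real ^ 'n \<Rightarrow> real ^ 'n ^ 'n) \<Rightarrow> (real ^ 'n \<Rightarrow> real ^ 'n) \<Rightarrow> (real ^ 'n \<Rightarrow> real)
    \<Rightarrow> real \<Rightarrow> (real ^ 'n \<Rightarrow> real) \<Rightarrow> (real ^ 'n \<Rightarrow> real ^ 'n) \<Rightarrow> (real ^ 'n \<Rightarrow> real) \<Rightarrow> bool" where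
  "is_weak_solution U A B c \<alpha> g G v \<longleftrightarrow> v \<in> H12_0 U \<and>
     (\<forall>\<phi>\<in>test_functions U.
        let lhs = (\<lambda>x. (A x *v weak_grad U v x) \<bullet> grad \<phi> x
                       + (B x \<bullet> weak_grad U v x + (c x + \<alpha>) * v x) * \<phi> x);
            rhs = (\<lambda>x. g x * \<phi> x + G x \<bullet> grad \<phi> x)
        in integrable (lebesgue_on U) lhs \<and> integrable (lebesgue_on U) rhs \<and>
           (\<integral>x. lhs x \<partial>lebesgue_on U) = (\<integral>x. rhs x \<partial>lebesgue_on U))"

text \<open>
  \<open>C\<close> is an energy constant for \<open>U\<close> and \<open>lam\<close> (and the fixed \<open>p = 2\<^sub>*\<close>): for all admissible data the
  weak solution, unique up to null sets, obeys the energy estimate. A constant that depends only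
  on \<open>lam\<close>, \<open>d\<close> and the measure of \<open>U\<close> is in particular such a \<open>C\<close>.
\<close>

definition energy_constant :: "real \<Rightarrow> (real ^ 'n) set \<Rightarrow> real \<Rightarrow> real \<Rightarrow> bool" where
  "energy_constant p U lam C \<longleftrightarrow> C > 0 \<and>
     (\<forall>A B c \<alpha> f F.
        assumption_A p U lam A B c \<and> \<alpha> \<ge> 0 \<and> in_Lp p U f \<and> in_Lp 2 U F \<longrightarrow>
        (\<exists>u. is_weak_solution U A B c \<alpha> f F u \<and>
             (\<forall>w. is_weak_solution U A B c \<alpha> f F w \<longrightarrow> (AE x in lebesgue_on U. w x = u x)) \<and>
             H12_norm U u \<le> C * (Lp_norm p U f + Lp_norm 2 U F)))"

end

theory Submission
  imports Defs
begin

text \<open>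
  Let \<open>u\<close> be the energy solution with right-hand side \<open>- div G\<close>; the energy constant and the
  Cauchy-Schwarz inequality bound its \<open>L\<^sup>1\<close> norm. The difference \<open>w = v - u\<close> solves the equation with
  right-hand side \<open>g\<close> alone. Testing with \<open>T(N w)\<close>, where \<open>T s = s / sqrt (1 + s\<^sup>2)\<close> is a smooth
  bounded approximation of the sign, makes the second order term nonnegative by ellipticity and the
  drift term nonnegative because \<open>T(N w) \<nabla>w\<close> is the gradient of a nonnegative function and
  \<open>div B \<le> 0\<close>. Hence \<open>\<alpha> \<integral> w T(N w) \<le> \<integral> \<bar>g\<bar>\<close>, and \<open>N \<rightarrow> \<infinity>\<close> gives \<open>\<alpha> \<parallel>w\<parallel>\<^sub>1 \<le> \<parallel>g\<parallel>\<^sub>1\<close>. As \<open>w\<close> is only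
  a limit of test functions, \<open>c w\<close> must be integrable, which would usually come from the Sobolev
  inequality; here it follows from the energy estimate by duality.
\<close>

section \<open>Smooth functions\<close>

text \<open>Only test functions may be inserted into the equation, so T is composed with a test
  function \<phi> near w, not with w, and no chain rule for Sobolev functions enters. Since
  \<bar>T\<bar> \<le> 1 and 0 < T' \<le> 1, the replacement costs only a constant times the
  \<open>L\<^sup>2\<close> distance of the two gradients. A bounded T is also forced by the data: g
  and the inner product of B with the gradient of w are merely integrable. As \<phi> runs through an
  approximating sequence, (c + \<alpha>) w T(\<phi>) has to converge under the integral, and the
  integrability of c w supplies the majorant. The factor N is not carried through the testing: N w
  solves the equation with right-hand side N g, so it is enough to test with T(w) and rescale. A
  separate obstacle is that \<open>weak_grad\<close> is an arbitrary choice. The norm of u - \<phi>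
  refers to the gradient chosen for that difference, and relating it to the gradients of u and
  \<phi> takes a.e. uniqueness. This is why the fundamental lemma and integration by parts are
  developed from explicit smooth functions.\<close>

lemma grad_eqI:
  assumes "(f has_derivative f') (at x)"
  shows "grad f x $ i = f' (axis i 1)"
  using frechet_derivative_at[OF assms] by (simp add: grad_def)

lemma has_derivative_grad:
  fixes f :: "real ^ 'n \<Rightarrow> real"
  assumes "f differentiable (at x)"
  shows "(f has_derivative (\<lambda>h. grad f x \<bullet> h)) (at x)"
proof -
  have d: "(f has_derivative frechet_derivative f (at x)) (at x)"
    using assms frechet_derivative_works by blast
  then interpret linear "frechet_derivative f (at x)"
    by (rule has_derivative_linear)
  have "frechet_derivative f (at x) h = grad f x \<bullet> h" for h
  proof -
    have "frechet_derivative f (at x) h = frechet_derivative f (at x) (\<Sum>i\<in>UNIV. h $ i *\<^sub>R axis i 1)"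
      using basis_expansion[of h] by (simp add: scalar_mult_eq_scaleR)
    also have "\<dots> = (\<Sum>i\<in>UNIV. h $ i * frechet_derivative f (at x) (axis i 1))"
      by (simp add: sum scaleR)
    finally show ?thesis by (simp add: grad_def inner_vec_def mult.commute)
  qed
  then show ?thesis using d by (metis (no_types, lifting) ext)
qed

text \<open>The product rule leaves one factor undifferentiated, so the induction for products meets
  a factor of class k + 1 where class k is asked for.\<close>

lemma Ck_mono: "Ck (Suc k) f \<Longrightarrow> Ck k f"
proof (induction k arbitrary: f)
  case 0
  then show ?case
    by (auto simp: continuous_on_eq_continuous_at intro: differentiable_imp_continuous_within)
next
  case (Suc k)
  then show ?case by (metis Ck.simps(2))
qed

lemma grad_const: "grad (\<lambda>x. a) x = 0"
  by (simp add: vec_eq_iff grad_eqI[OF has_derivative_const])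

lemma Ck_const: "Ck k (\<lambda>x. a)"
  by (induction k arbitrary: a) (auto simp: grad_const)

lemma grad_coord: "grad (\<lambda>x::real^'n. x $ j) x $ i = (if i = j then 1 else 0)"
proof -
  have "((\<lambda>x::real^'n. x $ j) has_derivative (\<lambda>h. h $ j)) (at x)"
    by (intro bounded_linear_imp_has_derivative bounded_linear_vec_nth)
  from grad_eqI[OF this] show ?thesis by (auto simp: axis_def)
qed

lemma Ck_coord: "Ck k (\<lambda>x::real^'n. x $ j)"
proof (cases k)
  case 0
  then show ?thesis by (auto intro!: continuous_intros)
next
  case (Suc m)
  have "(\<lambda>x::real^'n. x $ j) differentiable (at x)" for x
    using bounded_linear_imp_differentiable bounded_linear_vec_nth by blast
  then show ?thesis by (simp add: Suc grad_coord Ck_const)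
qed

lemma grad_add:
  assumes "f differentiable (at x)" "g differentiable (at x)"
  shows "grad (\<lambda>x. f x + g x) x = grad f x + grad g x"
  using grad_eqI[OF has_derivative_add[OF assms[THEN has_derivative_grad]]]
  by (simp add: vec_eq_iff inner_axis)

lemma grad_mult:
  assumes "f differentiable (at x)" "g differentiable (at x)"
  shows "grad (\<lambda>x. f x * g x) x = f x *\<^sub>R grad g x + g x *\<^sub>R grad f x"
  using grad_eqI[OF has_derivative_mult[OF assms[THEN has_derivative_grad]]]
  by (simp add: vec_eq_iff inner_axis algebra_simps)

lemma has_derivative_chain:
  fixes f :: "real ^ 'n \<Rightarrow> real"
  assumes "f differentiable (at x)" "(h has_real_derivative d) (at (f x))"
  shows "((\<lambda>x. h (f x)) has_derivative (\<lambda>v. d * (grad f x \<bullet> v))) (at x)"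
  using has_derivative_compose[OF has_derivative_grad[OF assms(1)]
      assms(2)[unfolded has_field_derivative_def]] by simp

lemma grad_chain:
  assumes "f differentiable (at x)" "(h has_real_derivative d) (at (f x))"
  shows "grad (\<lambda>x. h (f x)) x = d *\<^sub>R grad f x"
  using grad_eqI[OF has_derivative_chain[OF assms]]
  by (simp add: vec_eq_iff inner_axis)

lemma Ck_add: "Ck k f \<Longrightarrow> Ck k g \<Longrightarrow> Ck k (\<lambda>x. f x + g x)"
proof (induction k arbitrary: f g)
  case 0
  then show ?case by (auto intro: continuous_intros)
next
  case (Suc k)
  then show ?case by (simp add: grad_add)
qed

lemma Ck_mult: "Ck k f \<Longrightarrow> Ck k g \<Longrightarrow> Ck k (\<lambda>x. f x * g x)"
proof (induction k arbitrary: f g)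
  case 0
  then show ?case by (auto intro: continuous_intros)
next
  case (Suc k)
  note sm = Suc.prems[THEN Ck_mono]
  show ?case using Suc.prems sm by (auto simp: grad_mult intro!: Ck_add Suc.IH)
qed

lemma Ck_diff: "Ck k f \<Longrightarrow> Ck k g \<Longrightarrow> Ck k (\<lambda>x. f x - g x)"
  using Ck_add[of k f "\<lambda>x. - 1 * g x"] Ck_mult[OF Ck_const, of k g "- 1"] by simp

lemma Ck_prod: "finite I \<Longrightarrow> (\<And>i. i \<in> I \<Longrightarrow> Ck k (f i)) \<Longrightarrow> Ck k (\<lambda>x. \<Prod>i\<in>I. f i x)"
  by (induction I rule: finite_induct) (auto intro: Ck_const Ck_mult)

section \<open>The smooth approximate sign and its primitive\<close>

text \<open>Smoothness of compositions is proved by induction, since the derivatives of \<open>rs\<close> and of the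
  functions \<open>bump m\<close> are polynomials in the argument and the functions of the same family.\<close>

definition rs :: "real \<Rightarrow> real" where "rs s = 1 / sqrt (1 + s\<^sup>2)"

lemma one_plus_sq_pos: "1 + (s::real)\<^sup>2 > 0" "1 + (s::real)\<^sup>2 \<noteq> 0"
  by (simp_all add: add_pos_nonneg add_nonneg_eq_0_iff)

lemma rs_pos: "rs s > 0"
  using one_plus_sq_pos(1)[of s] by (simp add: rs_def)

lemma rs_le_1: "rs s \<le> 1"
  using one_plus_sq_pos(1)[of s] by (simp add: rs_def)

lemma rs_sq: "(rs s)\<^sup>2 * (1 + s\<^sup>2) = 1"
  using one_plus_sq_pos[of s] by (simp add: rs_def power_divide)

lemma one_plus_sq_mult_rs: "(1 + s\<^sup>2) * rs s = sqrt (1 + s\<^sup>2)"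
  using one_plus_sq_pos(1)[of s] by (simp add: rs_def real_div_sqrt)

text \<open>For s = tan \<theta> with \<bar>\<theta>\<bar> < pi / 2, \<open>rs s\<close> is cos
  \<theta> and \<open>s * rs s\<close> is sin \<theta>; \<open>rs_sq\<close> is then the Pythagorean
  identity.\<close>

lemma abs_mult_rs_le_1: "\<bar>s * rs s\<bar> \<le> 1"
proof -
  have "(s * rs s)\<^sup>2 = 1 - (rs s)\<^sup>2"
    using rs_sq[of s] by (simp add: power_mult_distrib distrib_left mult.commute)
  then have "(s * rs s)\<^sup>2 \<le> 1" by simp
  then show ?thesis by (simp only: abs_square_le_1)
qed

lemma DERIV_rs: "(rs has_real_derivative (- s * rs s ^ 3)) (at s)"
proof -
  have p: "1 + s\<^sup>2 > 0" by (rule one_plus_sq_pos)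
  have q: "((\<lambda>s. 1 + s\<^sup>2) has_real_derivative 2 * s) (at s)"
    by (auto intro!: derivative_eq_intros)
  have "((\<lambda>s. inverse (sqrt (1 + s\<^sup>2))) has_real_derivative
      - (inverse (sqrt (1 + s\<^sup>2)) * (inverse (sqrt (1 + s\<^sup>2)) / 2 * (2 * s)) * inverse (sqrt (1 + s\<^sup>2)))) (at s)"
    using p by (intro DERIV_inverse' DERIV_chain2[OF DERIV_real_sqrt q]) auto
  moreover have "- (r * (r / 2 * (2 * s)) * r) = - s * r ^ 3" for r :: real
    by (simp add: power3_eq_cube)
  moreover have rs_eq: "rs = (\<lambda>s. inverse (sqrt (1 + s\<^sup>2)))"
    by (simp add: rs_def[abs_def] inverse_eq_divide)
  ultimately show ?thesis unfolding rs_eq by (simp only:)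
qed

text \<open>Both bounds 0 < \<open>rs s ^ 3\<close> \<le> 1 matter later: the lower one preserves
  the sign given by ellipticity, the upper one controls the error of replacing one gradient by
  another.\<close>

lemma DERIV_mult_rs: "((\<lambda>s. s * rs s) has_real_derivative (rs s ^ 3)) (at s)"
proof -
  have "((\<lambda>s. s * rs s) has_real_derivative (1 * rs s + (- s * rs s ^ 3) * s)) (at s)"
    by (rule DERIV_mult DERIV_ident DERIV_rs)+
  moreover have "1 * rs s + (- s * rs s ^ 3) * s = rs s ^ 3"
  proof -
    have "rs s = rs s * ((rs s)\<^sup>2 * (1 + s\<^sup>2))" by (simp add: rs_sq del: One_nat_def)
    also have "\<dots> = rs s ^ 3 + s * rs s ^ 3 * s" by (simp add: power2_eq_square power3_eq_cube algebra_simps)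
    finally show ?thesis by simp
  qed
  ultimately show ?thesis by simp
qed

text \<open>The function is sqrt (1 + \<open>s\<^sup>2\<close>) - 1, the primitive of
  \<open>s * rs s\<close> that vanishes at 0. Written as a polynomial in s and \<open>rs s\<close>,
  it inherits smoothness from \<open>Ck_rs\<close> and the product rule.\<close>

lemma DERIV_sqrt_minus_1: "((\<lambda>s. (1 + s\<^sup>2) * rs s - 1) has_real_derivative (s * rs s)) (at s)"
proof -
  have q: "((\<lambda>s. 1 + s\<^sup>2) has_real_derivative 2 * s) (at s)"
    by (auto intro!: derivative_eq_intros)
  have "((\<lambda>s. (1 + s\<^sup>2) * rs s - 1) has_real_derivative (2 * s * rs s + (- s * rs s ^ 3) * (1 + s\<^sup>2)) - 0) (at s)"
    by (rule DERIV_diff DERIV_mult q DERIV_const DERIV_rs)+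
  moreover have "2 * s * rs s + (- s * rs s ^ 3) * (1 + s\<^sup>2) - 0 = s * rs s"
  proof -
    have "(- s * rs s ^ 3) * (1 + s\<^sup>2) = - s * rs s * ((rs s)\<^sup>2 * (1 + s\<^sup>2))"
      by (simp add: power2_eq_square power3_eq_cube algebra_simps)
    then show ?thesis unfolding rs_sq by (simp only: mult_1_right)
  qed
  ultimately show ?thesis by (simp only:)
qed

lemma sqrt_minus_1_nonneg: "(1 + s\<^sup>2) * rs s - 1 \<ge> 0"
  by (simp add: one_plus_sq_mult_rs)

text \<open>The gap between \<bar>s\<bar> and \<open>s * (s * rs s)\<close> stays bounded for all s.
  Replacing s by N s and dividing by N therefore leaves an error of order 1 / N.\<close>

lemma mult_mult_rs_ge: "s * (s * rs s) \<ge> \<bar>s\<bar> - 1"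
proof -
  have "s * (s * rs s) = (1 + s\<^sup>2) * rs s - rs s"
    by (simp add: power2_eq_square algebra_simps)
  also have "\<dots> = sqrt (1 + s\<^sup>2) - rs s" by (simp only: one_plus_sq_mult_rs)
  also have "\<dots> \<ge> \<bar>s\<bar> - 1"
    using rs_le_1[of s] real_le_rsqrt[of "\<bar>s\<bar>" "1 + s\<^sup>2"] by simp
  finally show ?thesis .
qed

lemma continuous_rs: "isCont rs s"
  using DERIV_rs DERIV_isCont by blast

lemma Ck_rs:
  assumes "\<And>k. Ck k f"
  shows "Ck k (\<lambda>x. rs (f x))"
proof (induction k)
  case 0
  have "continuous_on UNIV f" using assms[of 0] by simp
  then show ?case
    using continuous_rs by (auto simp: continuous_on_eq_continuous_at intro: isCont_o2)
next
  case (Suc k)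
  have d: "f differentiable (at x)" for x using assms[of 1] by simp
  have "(\<lambda>x. rs (f x)) differentiable (at x)" for x
    using has_derivative_chain[OF d DERIV_rs] by (auto simp: differentiable_def)
  moreover have "Ck k (\<lambda>x. grad f x $ i)" for i using assms[of "Suc k"] by simp
  then have "Ck k (\<lambda>x. (- 1 * f x * (rs (f x) * (rs (f x) * rs (f x)))) * grad f x $ i)" for i
    by (intro Ck_mult Ck_const assms Suc.IH)
  ultimately show ?case
    by (simp add: grad_chain[OF d DERIV_rs] power3_eq_cube mult.assoc)
qed

section \<open>Smooth functions that vanish on a half-line\<close>

definition bump :: "nat \<Rightarrow> real \<Rightarrow> real" where
  "bump m t = (if t > 0 then (1 / t) ^ m * exp (- (1 / t)) else 0)"

lemma bump_nonneg: "bump m t \<ge> 0"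
  by (simp add: bump_def)

text \<open>This is the difference quotient at 0, the point where the two branches of
  \<open>bump\<close> meet. From the right, the substitution t = 1 / x turns it into
  \<open>x ^ Suc m / exp x\<close> with x tending to infinity.\<close>

lemma bump_div_tendsto_0: "((\<lambda>t. bump m t / t) \<longlongrightarrow> 0) (at 0)"
proof -
  have "((\<lambda>x. x ^ Suc m / exp x) \<longlongrightarrow> 0) (at_top :: real filter)"
    by (rule tendsto_power_div_exp_0)
  then have "((\<lambda>t. inverse t ^ Suc m / exp (inverse t)) \<longlongrightarrow> 0) (at_right (0::real))"
    using filterlim_inverse_at_top_right filterlim_compose by blast
  then have R: "((\<lambda>t. bump m t / t) \<longlongrightarrow> 0) (at_right 0)"
    by (rule Lim_transform_eventually)
      (auto simp: eventually_at_right_less bump_def exp_minus divide_inverse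
        intro!: eventually_at_rightI[of 0 1])
  have "((\<lambda>t. bump m t / t) \<longlongrightarrow> 0) (at_left 0)"
    by (rule Lim_transform_eventually[OF tendsto_const])
       (auto simp: bump_def intro!: eventually_at_leftI[of "-1" 0])
  with R show ?thesis by (simp add: filterlim_split_at)
qed

lemma DERIV_bump: "(bump m has_real_derivative (bump (m + 2) t - real m * bump (m + 1) t)) (at t)"
proof -
  consider "t > 0" | "t = 0" | "t < 0" by linarith
  then show ?thesis
  proof cases
    case 1
    have u: "((\<lambda>t. 1 / t) has_real_derivative (- ((1 / t) * (1 / t)))) (at t)"
      using 1 by (auto intro!: derivative_eq_intros)
    have "((\<lambda>t. (1 / t) ^ m * exp (- (1 / t))) has_real_derivative
        real m * (- ((1 / t) * (1 / t)) * (1 / t) ^ (m - Suc 0)) * exp (- (1 / t))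
        + exp (- (1 / t)) * (- (- ((1 / t) * (1 / t)))) * (1 / t) ^ m) (at t)"
      by (intro DERIV_mult DERIV_power DERIV_fun_exp DERIV_minus u)
    \<comment> \<open>The case split on m settles the exponent \<open>m - Suc 0\<close>, which is
      truncated at m = 0; there the factor \<open>real m\<close> is zero.\<close>
    moreover have "real m * (- ((1 / t) * (1 / t)) * (1 / t) ^ (m - Suc 0)) * exp (- (1 / t))
        + exp (- (1 / t)) * (- (- ((1 / t) * (1 / t)))) * (1 / t) ^ m
        = bump (m + 2) t - real m * bump (m + 1) t"
      using 1 by (cases m) (simp_all add: bump_def algebra_simps del: power_one_over)
    ultimately have "((\<lambda>t. (1 / t) ^ m * exp (- (1 / t))) has_real_derivative
        bump (m + 2) t - real m * bump (m + 1) t) (at t)"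
      by (simp only:)
    then show ?thesis
      by (rule has_field_derivative_transform_within_open[where S="{0<..}"])
        (use 1 in \<open>auto simp: bump_def\<close>)
  next
    case 2
    have "(bump m has_real_derivative 0) (at 0)"
      unfolding DERIV_def using bump_div_tendsto_0[of m] by (simp add: bump_def)
    then show ?thesis using 2 by (simp add: bump_def)
  next
    case 3
    have "((\<lambda>t. 0) has_real_derivative (bump (m + 2) t - real m * bump (m + 1) t)) (at t)"
      using 3 by (simp add: bump_def)
    then show ?thesis
      by (rule has_field_derivative_transform_within_open[where S="{..<0}"])
        (use 3 in \<open>auto simp: bump_def\<close>)
  qed
qed

lemma Ck_bump:
  assumes "\<And>k. Ck k f"
  shows "Ck k (\<lambda>x. bump m (f x))"
\<comment> \<open>The index m must stay arbitrary, since differentiation raises it to m + 1 and m +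
  2.\<close>
proof (induction k arbitrary: m)
  case 0
  have "continuous_on UNIV f" using assms[of 0] by simp
  moreover have "isCont (bump m) t" for t using DERIV_bump DERIV_isCont by blast
  ultimately show ?case
    by (auto simp: continuous_on_eq_continuous_at intro: isCont_o2)
next
  case (Suc k)
  have d: "f differentiable (at x)" for x using assms[of 1] by simp
  have "(\<lambda>x. bump m (f x)) differentiable (at x)" for x
    using has_derivative_chain[OF d DERIV_bump] by (auto simp: differentiable_def)
  moreover have "Ck k (\<lambda>x. grad f x $ i)" for i using assms[of "Suc k"] by simp
  then have "Ck k (\<lambda>x. (bump (m + 2) (f x) - real m * bump (m + 1) (f x)) * grad f x $ i)" for i
    by (intro Ck_mult Ck_diff Ck_const Suc.IH)
  ultimately show ?case
    by (simp add: grad_chain[OF d DERIV_bump])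
qed

section \<open>Test functions and the fundamental lemma of the calculus of variations\<close>

lemma test_functionsI:
  assumes "\<And>k. Ck k \<phi>" "compact K" "K \<subseteq> U" "\<And>x. x \<notin> K \<Longrightarrow> \<phi> x = 0"
  shows "\<phi> \<in> test_functions U"
proof -
  have "closure {x. \<phi> x \<noteq> 0} \<subseteq> K"
    using assms by (intro closure_minimal) (auto intro: compact_imp_closed)
  moreover from this have "compact (closure {x. \<phi> x \<noteq> 0})"
    using compact_Int_closed[OF assms(2) closed_closure, of "{x. \<phi> x \<noteq> 0}"] by (simp add: Int_absorb1)
  ultimately show ?thesis using assms by (auto simp: test_functions_def)
qed

lemma test_functions_Ck: "\<phi> \<in> test_functions U \<Longrightarrow> Ck k \<phi>"
  by (simp add: test_functions_def)

lemma test_functions_differentiable: "\<phi> \<in> test_functions U \<Longrightarrow> \<phi> differentiable (at x)"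
  using test_functions_Ck[of \<phi> U 1] by simp

lemma test_functions_continuous: "\<phi> \<in> test_functions U \<Longrightarrow> continuous_on UNIV \<phi>"
  using test_functions_Ck[of \<phi> U 0] by simp

lemma test_functions_grad_continuous:
  assumes "\<phi> \<in> test_functions U"
  shows "continuous_on UNIV (grad \<phi>)"
proof -
  have "continuous_on UNIV (\<lambda>x. \<chi> i. grad \<phi> x $ i)"
    using test_functions_Ck[OF assms, of 1] by (intro continuous_on_vec_lambda) simp
  then show ?thesis by simp
qed

lemma test_functionsE:
  fixes \<phi> :: "real ^ 'n \<Rightarrow> real"
  assumes "\<phi> \<in> test_functions U"
  obtains K M where "compact K" "K \<subseteq> U" "\<And>x. x \<notin> K \<Longrightarrow> \<phi> x = 0" "\<And>x. x \<notin> K \<Longrightarrow> grad \<phi> x = 0"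
    "\<And>x. \<bar>\<phi> x\<bar> \<le> M" "\<And>x. norm (grad \<phi> x) \<le> M"
proof -
  define K where "K = closure {x. \<phi> x \<noteq> 0}"
  have K: "compact K" "K \<subseteq> U" using assms by (auto simp: K_def test_functions_def)
  have z: "\<phi> x = 0" if "x \<notin> K" for x
    using that closure_subset[of "{x. \<phi> x \<noteq> 0}"] by (auto simp: K_def)
  have gz: "grad \<phi> x = 0" if "x \<notin> K" for x
  proof -
    have "open (- K)" using K(1) by (simp add: compact_imp_closed open_Compl)
    then have "(\<phi> has_derivative (\<lambda>h. 0)) (at x)"
      using that z by (intro has_derivative_transform_within_open[OF has_derivative_const[of 0] \<open>open (- K)\<close>]) auto
    from grad_eqI[OF this] show ?thesis by (simp add: vec_eq_iff)
  qed
  have "bounded (\<phi> ` K)" "bounded (grad \<phi> ` K)"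
    using K(1) test_functions_continuous[OF assms] test_functions_grad_continuous[OF assms]
    by (auto intro!: compact_imp_bounded compact_continuous_image intro: continuous_on_subset)
  then obtain M1 M2 where M: "\<And>x. x \<in> K \<Longrightarrow> \<bar>\<phi> x\<bar> \<le> M1" "\<And>x. x \<in> K \<Longrightarrow> norm (grad \<phi> x) \<le> M2"
    by (auto simp: bounded_iff)
  have "\<bar>\<phi> x\<bar> \<le> max 0 (max M1 M2)" "norm (grad \<phi> x) \<le> max 0 (max M1 M2)" for x
    using M[of x] z[of x] gz[of x] by (cases "x \<in> K"; force)+
  then show ?thesis using that K z gz by blast
qed

lemma test_functions_diff:
  assumes "\<phi> \<in> test_functions U" "\<psi> \<in> test_functions U"
  shows "(\<lambda>x. \<phi> x - \<psi> x) \<in> test_functions U"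
proof -
  obtain K1 M1 K2 M2 where "compact K1" "K1 \<subseteq> U" "\<And>x. x \<notin> K1 \<Longrightarrow> \<phi> x = 0"
    "compact K2" "K2 \<subseteq> U" "\<And>x. x \<notin> K2 \<Longrightarrow> \<psi> x = 0"
    using test_functionsE[OF assms(1)] test_functionsE[OF assms(2)] by metis
  then show ?thesis
    by (intro test_functionsI[of _ "K1 \<union> K2"] Ck_diff)
       (auto intro: assms[THEN test_functions_Ck])
qed

text \<open>The condition \<open>h 0 = 0\<close> keeps the support inside that of \<phi>; this is
  why 1 is subtracted from the square root in the primitive of \<open>s * rs s\<close>.\<close>

lemma test_functions_compose:
  assumes "\<phi> \<in> test_functions U" "\<And>k. Ck k (\<lambda>x. h (\<phi> x))" "h 0 = 0"
  shows "(\<lambda>x. h (\<phi> x)) \<in> test_functions U"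
proof -
  obtain K M where "compact K" "K \<subseteq> U" "\<And>x. x \<notin> K \<Longrightarrow> \<phi> x = 0"
    using test_functionsE[OF assms(1)] by metis
  then show ?thesis using assms by (intro test_functionsI[of _ K]) auto
qed

lemma test_functions_scale:
  assumes "\<phi> \<in> test_functions U"
  shows "(\<lambda>x. a * \<phi> x) \<in> test_functions U"
  using assms test_functions_Ck[OF assms]
  by (intro test_functions_compose[of \<phi> U "\<lambda>t. a * t"] Ck_mult Ck_const) auto

lemma test_functions_mult_rs:
  assumes "\<phi> \<in> test_functions U"
  shows "(\<lambda>x. \<phi> x * rs (\<phi> x)) \<in> test_functions U"
  using test_functions_Ck[OF assms]
  by (intro test_functions_compose[of \<phi> U "\<lambda>t. t * rs t"] assms Ck_mult Ck_rs) auto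

lemma test_functions_sqrt_minus_1:
  assumes "\<phi> \<in> test_functions U"
  shows "(\<lambda>x. (1 + (\<phi> x)\<^sup>2) * rs (\<phi> x) - 1) \<in> test_functions U"
  using test_functions_Ck[OF assms] unfolding power2_eq_square
  by (intro test_functions_compose[of \<phi> U "\<lambda>t. (1 + t * t) * rs t - 1"] assms Ck_mult Ck_rs Ck_diff Ck_const Ck_add)
     (auto simp: rs_def)

lemma test_functions_measurable:
  assumes "\<phi> \<in> test_functions U"
  shows "\<phi> \<in> borel_measurable (lebesgue_on S)" "grad \<phi> \<in> borel_measurable (lebesgue_on S)"
proof -
  have "\<phi> \<in> borel_measurable borel" "grad \<phi> \<in> borel_measurable borel"
    using test_functions_continuous[OF assms] test_functions_grad_continuous[OF assms]
    by (auto intro: borel_measurable_continuous_onI)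
  then show "\<phi> \<in> borel_measurable (lebesgue_on S)" "grad \<phi> \<in> borel_measurable (lebesgue_on S)"
    by (auto intro!: measurable_restrict_space1 measurable_completion)
qed

lemma integrable_mult_bounded:
  fixes f g :: "'a \<Rightarrow> real"
  assumes "integrable M f" "g \<in> borel_measurable M" "AE x in M. \<bar>g x\<bar> \<le> C"
  shows "integrable M (\<lambda>x. f x * g x)"
proof (rule Bochner_Integration.integrable_bound[where f="\<lambda>x. C * f x"])
  show "integrable M (\<lambda>x. C * f x)" "(\<lambda>x. f x * g x) \<in> borel_measurable M"
    using assms by auto
  show "AE x in M. norm (f x * g x) \<le> norm (C * f x)"
    using assms(3)
  proof eventually_elim
    case (elim x)
    then have "\<bar>g x\<bar> \<le> \<bar>C\<bar>" by linarith
    then have "\<bar>f x\<bar> * \<bar>g x\<bar> \<le> \<bar>f x\<bar> * \<bar>C\<bar>" by (rule mult_left_mono) simp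
    then show ?case by (simp add: abs_mult mult.commute)
  qed
qed

lemma integral_lebesgue_on:
  assumes "S \<in> sets lebesgue"
  shows "integral\<^sup>L (lebesgue_on S) f = (\<integral>x. indicator S x *\<^sub>R (f x :: 'b :: euclidean_space) \<partial>lebesgue)"
    and "integrable (lebesgue_on S) f \<longleftrightarrow> integrable lebesgue (\<lambda>x. indicator S x *\<^sub>R f x)"
  using assms by (auto simp: integral_restrict_space integrable_restrict_space)

text \<open>Local integrability controls f on compact sets only. As \<phi> vanishes off K, the
  product is unchanged when f is cut off to K.\<close>

lemma integrable_locally_integrable_mult:
  fixes f \<phi> :: "real ^ 'n \<Rightarrow> real"
  assumes "locally_integrable U f" "U \<in> sets lebesgue" "compact K" "K \<subseteq> U"
    and "\<phi> \<in> borel_measurable lebesgue" "\<And>x. x \<notin> K \<Longrightarrow> \<phi> x = 0" "\<And>x. \<bar>\<phi> x\<bar> \<le> M"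
  shows "integrable (lebesgue_on U) (\<lambda>x. f x * \<phi> x)"
proof -
  have K: "K \<in> sets lebesgue"
    using assms(3) by (simp add: borel_compact)
  have "integrable (lebesgue_on K) f"
    using assms by (auto simp: locally_integrable_def)
  then have "integrable lebesgue (\<lambda>x. (indicator K x *\<^sub>R f x) * \<phi> x)"
    using assms K by (intro integrable_mult_bounded[where C=M]) (auto simp: integral_lebesgue_on)
  moreover have "(\<lambda>x. (indicator K x *\<^sub>R f x) * \<phi> x) = (\<lambda>x. indicator U x *\<^sub>R (f x * \<phi> x))"
    using assms by (auto simp: indicator_def fun_eq_iff)
  ultimately show ?thesis using assms(2) by (simp add: integral_lebesgue_on)
qed

section \<open>From orthogonality to test functions to orthogonality to indicators of boxes\<close>

definition box_bump :: "real ^ 'n \<Rightarrow> real ^ 'n \<Rightarrow> real ^ 'n \<Rightarrow> real" where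
  "box_bump a b x = (\<Prod>i\<in>UNIV. bump 0 ((x $ i - a $ i) * (b $ i - x $ i)))"

lemma Ck_box_bump: "Ck k (box_bump a b)"
proof -
  have "Ck k (\<lambda>x. \<Prod>i\<in>UNIV. bump 0 ((x $ i - a $ i) * (b $ i - x $ i)))"
    by (intro Ck_prod Ck_bump Ck_mult Ck_diff Ck_coord Ck_const) auto
  then show ?thesis by (simp add: box_bump_def[abs_def])
qed

lemma box_bump_nonneg: "box_bump a b x \<ge> 0"
  by (simp add: box_bump_def prod_nonneg bump_nonneg)

text \<open>For \<open>a $ i < b $ i\<close> the parabola inside \<open>bump\<close> is positive
  exactly between the two roots. Nonemptiness of the box guarantees this order of the roots; with
  the roots swapped, the parabola would be positive between them as well.\<close>

lemma box_bump_eq_0_iff: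
  assumes "box a b \<noteq> {}"
  shows "box_bump a b x = 0 \<longleftrightarrow> x \<notin> box a b"
proof -
  obtain y where "y \<in> box a b" using assms by blast
  then have "a $ i < b $ i" for i by (meson mem_box_cart less_trans)
  then have "0 < (x $ i - a $ i) * (b $ i - x $ i) \<longleftrightarrow> a $ i < x $ i \<and> x $ i < b $ i" for i
    by (smt (verit) zero_less_mult_iff)
  then show ?thesis
    by (auto simp: box_bump_def mem_box_cart bump_def split: if_splits)
qed

text \<open>The lower bound of the squeeze is \<open>mult_mult_rs_ge\<close> divided by its positive
  argument.\<close>

lemma mult_rs_tendsto_1:
  assumes "t > 0"
  shows "(\<lambda>n. (real n * t) * rs (real n * t)) \<longlonglongrightarrow> 1"
proof (rule tendsto_sandwich)
  have "1 - 1 / (real n * t) \<le> (real n * t) * rs (real n * t)" if "n > 0" for n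
  proof -
    have p: "real n * t > 0" using that assms by (intro mult_pos_pos) auto
    have "(real n * t) * (1 - 1 / (real n * t)) = real n * t - 1"
      using that assms by (simp add: right_diff_distrib)
    also have "\<dots> \<le> (real n * t) * ((real n * t) * rs (real n * t))"
      using mult_mult_rs_ge[of "real n * t"] p by simp
    finally show ?thesis using p by (rule mult_left_le_imp_le)
  qed
  then show "\<forall>\<^sub>F n in sequentially. 1 - 1 / (real n * t) \<le> (real n * t) * rs (real n * t)"
    by (rule eventually_mono[OF eventually_gt_at_top[of 0]])
  have "(real n * t) * rs (real n * t) \<le> 1" for n
    using abs_mult_rs_le_1[of "real n * t"] by linarith
  then show "\<forall>\<^sub>F n in sequentially. (real n * t) * rs (real n * t) \<le> 1" by simp
  have "(\<lambda>n. 1 - (1 / t) * inverse (real n)) \<longlonglongrightarrow> 1 - (1 / t) * 0"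
    by (intro tendsto_intros lim_inverse_n)
  then show "(\<lambda>n. 1 - 1 / (real n * t)) \<longlonglongrightarrow> 1"
    by (simp add: field_simps)
qed auto

lemma integral_box_eq_0:
  fixes h :: "real ^ 'n \<Rightarrow> real"
  assumes "open U" "locally_integrable U h"
    and orth: "\<And>\<phi>. \<phi> \<in> test_functions U \<Longrightarrow> (\<integral>x. h x * \<phi> x \<partial>lebesgue_on U) = 0"
    and "cbox a b \<subseteq> U"
  shows "(\<integral>x. indicator (box a b) x * h x \<partial>lebesgue) = 0"
proof (cases "box a b = {}")
  case False
  define \<psi> where "\<psi> n x = (real n * box_bump a b x) * rs (real n * box_bump a b x)" for n x
  have K: "cbox a b \<in> sets lebesgue" by simp
  have U: "U \<in> sets lebesgue" using assms(1) by (simp add: borel_open)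
  have out: "\<psi> n x = 0" if "x \<notin> box a b" for n x
    using that box_bump_eq_0_iff[OF False] by (simp add: \<psi>_def)
  have tf: "\<psi> n \<in> test_functions U" for n
  proof (rule test_functionsI)
    show "Ck k (\<psi> n)" for k
      unfolding \<psi>_def[abs_def]
      by (intro Ck_mult Ck_const Ck_box_bump Ck_rs)
    show "x \<notin> cbox a b \<Longrightarrow> \<psi> n x = 0" for x
      using out[of x n] box_subset_cbox[of a b] by blast
  qed (use assms in auto)
  have m: "\<psi> n \<in> borel_measurable lebesgue" for n
    using test_functions_measurable(1)[OF tf, where S=UNIV] by (simp add: lebesgue_on_UNIV_eq)
  have "integrable (lebesgue_on (cbox a b)) h"
    using assms by (auto simp: locally_integrable_def)
  then have i: "integrable lebesgue (\<lambda>x. indicator (cbox a b) x * h x)"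
    using K by (simp add: integral_lebesgue_on)
  have "(\<lambda>n. \<integral>x. indicator (cbox a b) x * h x * \<psi> n x \<partial>lebesgue)
      \<longlonglongrightarrow> (\<integral>x. indicator (box a b) x * h x \<partial>lebesgue)"
  proof (rule integral_dominated_convergence[where w="\<lambda>x. norm (indicator (cbox a b) x * h x)"])
    show "integrable lebesgue (\<lambda>x. norm (indicator (cbox a b) x * h x))"
      using i by (rule integrable_norm)
    show "(\<lambda>x. indicator (cbox a b) x * h x * \<psi> n x) \<in> borel_measurable lebesgue" for n
      by (rule borel_measurable_times[OF borel_measurable_integrable[OF i] m])
    have "(\<lambda>x. indicator (box a b) x * (indicator (cbox a b) x * h x)) \<in> borel_measurable lebesgue"
      by (intro borel_measurable_times borel_measurable_indicator borel_measurable_integrable[OF i]) auto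
    moreover have "(\<lambda>x. indicator (box a b) x * (indicator (cbox a b) x * h x)) = (\<lambda>x. indicator (box a b) x * h x)"
      using box_subset_cbox[of a b] by (auto simp: fun_eq_iff indicator_def)
    ultimately show "(\<lambda>x. indicator (box a b) x * h x) \<in> borel_measurable lebesgue" by simp
    have "norm (indicator (cbox a b) x * h x * \<psi> n x) \<le> norm (indicator (cbox a b) x * h x)" for n x
      unfolding norm_mult[of _ "\<psi> n x"] using abs_mult_rs_le_1
      by (intro mult_left_le) (auto simp: \<psi>_def)
    then show "AE x in lebesgue. norm (indicator (cbox a b) x * h x * \<psi> n x) \<le> norm (indicator (cbox a b) x * h x)" for n
      by simp
    have "(\<lambda>n. indicator (cbox a b) x * h x * \<psi> n x) \<longlonglongrightarrow> indicator (box a b) x * h x" for x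
    proof (cases "x \<in> box a b")
      case True
      then have "box_bump a b x > 0"
        using box_bump_eq_0_iff[OF False, of x] box_bump_nonneg[of a b x] by simp
      from tendsto_mult_left[OF mult_rs_tendsto_1[OF this], of "h x"] show ?thesis
        using True box_subset_cbox[of a b] by (auto simp: \<psi>_def)
    qed (simp add: out)
    then show "AE x in lebesgue. (\<lambda>n. indicator (cbox a b) x * h x * \<psi> n x) \<longlonglongrightarrow> indicator (box a b) x * h x"
      by simp
  qed
  moreover have "(\<integral>x. indicator (cbox a b) x * h x * \<psi> n x \<partial>lebesgue) = 0" for n
  proof -
    have "(\<lambda>x. indicator (cbox a b) x * h x * \<psi> n x) = (\<lambda>x. indicator U x *\<^sub>R (h x * \<psi> n x))"
      using assms(4) out box_subset_cbox[of a b] by (auto simp: fun_eq_iff indicator_def)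
    then show ?thesis using orth[OF tf[of n]] U by (simp add: integral_lebesgue_on)
  qed
  ultimately show ?thesis using LIMSEQ_unique[of "\<lambda>n. 0::real"] by fastforce
qed simp

text \<open>Open boxes form an intersection-stable generator of the Borel sets, and the sets over
  which f integrates to zero are closed under complements and countable disjoint unions. The
  complement step uses that the integral over the whole space is zero.\<close>

lemma AE_eq_0_if_integral_box_eq_0:
  fixes f :: "'a :: euclidean_space \<Rightarrow> real"
  assumes f: "integrable lebesgue f" and box: "\<And>a b. (LINT x:box a b|lebesgue. f x) = 0"
    and all: "(\<integral>x. f x \<partial>lebesgue) = 0"
  shows "AE x in lebesgue. f x = 0"
proof -
  let ?G = "range (\<lambda>(a, b). box a b :: 'a set)"
  have si: "set_integrable lebesgue E f" if "E \<in> sets lebesgue" for E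
    using integrable_mult_indicator[OF that f] by (simp add: set_integrable_def)
  have borel: "sigma_sets UNIV ?G = sets borel"
    by (simp add: borel_eq_box)
  have zero: "(LINT x:E|lebesgue. f x) = 0" if "E \<in> sets borel" for E
  proof -
    have "Int_stable ?G"
      by (auto simp: Int_stable_def box_Int_box)
    moreover have "?G \<subseteq> Pow UNIV" by simp
    moreover have "E \<in> sigma_sets UNIV ?G" using that borel by simp
    ultimately show ?thesis
    proof (induct rule: sigma_sets_induct_disjoint)
      case (compl E)
      then have E: "E \<in> sets lebesgue" using borel by auto
      have "(\<integral>x. f x \<partial>lebesgue) = (LINT x:(E \<union> (UNIV - E))|lebesgue. f x)"
        by (simp add: set_lebesgue_integral_def)
      also have "\<dots> = (LINT x:E|lebesgue. f x) + (LINT x:(UNIV - E)|lebesgue. f x)"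
        using E by (intro set_integral_Un si) auto
      finally show ?case using all compl by simp
    next
      case (union E)
      then have E: "E i \<in> sets lebesgue" for i using borel by auto
      have "(LINT x:(\<Union>i. E i)|lebesgue. f x) = (\<Sum>i. (LINT x:(E i)|lebesgue. f x))"
        using E union(1)
        by (intro lebesgue_integral_countable_add si) (auto simp: disjoint_family_on_def)
      then show ?case using union(3) by simp
    next
      case (basic E)
      then show ?case using box by auto
    qed (simp add: set_lebesgue_integral_def)
  qed
  \<comment> \<open>The set where f is positive is only Lebesgue measurable; a Borel version g of f
    makes the positivity set Borel, so that the vanishing of integrals applies to it.\<close>
  obtain g where g: "g \<in> borel_measurable lborel" "AE x in lborel. f x = g x"
    using completion_ex_borel_measurable_real[of f lborel] f by (auto dest: borel_measurable_integrable)
  have ae: "AE x in lebesgue. f x = g x" using g(2) by (rule AE_completion)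
  define E where "E = {x. g x > 0}"
  have [measurable]: "g \<in> borel_measurable borel" using g(1) by simp
  have "{x \<in> space borel. g x > 0} \<in> sets borel" by measurable
  then have E: "E \<in> sets borel" "- E \<in> sets borel" by (auto simp: E_def intro: borel_comp)
  have gi: "integrable lebesgue g"
    using Bochner_Integration.integrable_cong_AE_imp[OF f measurable_completion[OF g(1)] ae] .
  have cong: "(\<integral>x. indicator F x *\<^sub>R f x \<partial>lebesgue) = (\<integral>x. indicator F x *\<^sub>R g x \<partial>lebesgue)"
    if "F \<in> sets borel" for F
  proof (rule integral_cong_AE)
    have "F \<in> sets lebesgue" using that by simp
    then show "(\<lambda>x. indicator F x *\<^sub>R f x) \<in> borel_measurable lebesgue"
      "(\<lambda>x. indicator F x *\<^sub>R g x) \<in> borel_measurable lebesgue"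
      by (blast intro: borel_measurable_integrable integrable_mult_indicator f gi)+
    show "AE x in lebesgue. indicator F x *\<^sub>R f x = indicator F x *\<^sub>R g x"
      using ae by eventually_elim simp
  qed
  then have "(\<integral>x. indicator E x *\<^sub>R g x \<partial>lebesgue) = 0" "(\<integral>x. indicator (- E) x *\<^sub>R g x \<partial>lebesgue) = 0"
    using zero E cong by (auto simp: set_lebesgue_integral_def)
  moreover have "integrable lebesgue (\<lambda>x. indicator E x *\<^sub>R g x)" "integrable lebesgue (\<lambda>x. indicator (- E) x *\<^sub>R g x)"
    using E by (blast intro: integrable_mult_indicator gi sets_completionI_sets[of _ lborel, unfolded sets_lborel])+
  ultimately have "(\<integral>x. indicator E x *\<^sub>R g x - indicator (- E) x *\<^sub>R g x \<partial>lebesgue) = 0"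
    by simp
  also have "(\<lambda>x. indicator E x *\<^sub>R g x - indicator (- E) x *\<^sub>R g x) = (\<lambda>x. \<bar>g x\<bar>)"
    by (auto simp: fun_eq_iff E_def indicator_def)
  finally have "AE x in lebesgue. \<bar>g x\<bar> = 0"
    using gi by (subst (asm) integral_nonneg_eq_0_iff_AE) auto
  with ae show ?thesis by eventually_elim simp
qed

text \<open>h need not be integrable over U, so the criterion on boxes is applied to h cut off to
  one box at a time; U is a countable union of closed boxes.\<close>

lemma fundamental_lemma_of_calculus_of_variations:
  fixes h :: "real ^ 'n \<Rightarrow> real"
  assumes "open U" "locally_integrable U h"
    and orth: "\<And>\<phi>. \<phi> \<in> test_functions U \<Longrightarrow> (\<integral>x. h x * \<phi> x \<partial>lebesgue_on U) = 0"
  shows "AE x in lebesgue_on U. h x = 0"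
proof -
  have box: "AE x in lebesgue. x \<in> cbox a b \<longrightarrow> h x = 0" if ab: "cbox a b \<subseteq> U" for a b
  proof -
    define f where "f x = indicator (box a b) x * h x" for x
    have "integrable (lebesgue_on (cbox a b)) h"
      using assms ab by (auto simp: locally_integrable_def)
    then have "integrable lebesgue (\<lambda>x. indicator (cbox a b) x * h x)"
      by (simp add: integral_lebesgue_on)
    then have "integrable lebesgue (\<lambda>x. indicator (box a b) x *\<^sub>R (indicator (cbox a b) x * h x))"
      by (intro integrable_mult_indicator) auto
    also have "(\<lambda>x. indicator (box a b) x *\<^sub>R (indicator (cbox a b) x * h x)) = f"
      using box_subset_cbox[of a b] by (auto simp: fun_eq_iff indicator_def f_def)
    finally have i: "integrable lebesgue f" .
    have z: "(LINT x:box c d|lebesgue. f x) = 0" for c d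
    proof -
      obtain c' d' where cd: "box c d \<inter> box a b = box c' d'" using box_Int_box[of c d a b] by blast
      have "(LINT x:box c d|lebesgue. f x) = (\<integral>x. indicator (box c' d') x * h x \<partial>lebesgue)"
        unfolding cd[symmetric] set_lebesgue_integral_def
        by (intro Bochner_Integration.integral_cong) (auto simp: f_def indicator_def)
      also have "\<dots> = 0"
      proof (cases "box c' d' = {}")
        case False
        \<comment> \<open>\<open>integral_box_eq_0\<close> asks for the closed box inside U. A
          nonempty open box is dense in its closed box, which therefore stays inside the closed set
          \<open>cbox a b\<close>.\<close>
        have "box c' d' \<subseteq> cbox a b" using cd box_subset_cbox[of a b] by auto
        then have "cbox c' d' \<subseteq> cbox a b"
          using False closure_minimal[OF _ closed_cbox, of "box c' d'" a b] by (simp add: closure_box)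
        then show ?thesis using integral_box_eq_0[OF assms] ab by blast
      qed simp
      finally show ?thesis .
    qed
    have "AE x in lebesgue. f x = 0"
      using AE_eq_0_if_integral_box_eq_0[OF i z] integral_box_eq_0[OF assms ab] by (simp add: f_def)
    \<comment> \<open>The cut-off uses the open box while the cover of U uses closed ones; the
      difference is a null set.\<close>
    moreover have "AE x in lebesgue. x \<notin> cbox a b - box a b"
      using negligible_frontier_interval[of a b] by (intro AE_not_in) (simp add: negligible_iff_null_sets)
    ultimately show ?thesis by eventually_elim (auto simp: f_def)
  qed
  obtain D where D: "countable D" "\<And>X. X \<in> D \<Longrightarrow> X \<subseteq> U" "\<And>X. X \<in> D \<Longrightarrow> \<exists>a b. X = cbox a b" "\<Union>D = U"
    using open_countable_Union_open_cbox[OF assms(1)] by (metis PowD subsetD)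
  have "AE x in lebesgue. x \<in> X \<longrightarrow> h x = 0" if "X \<in> D" for X
  proof -
    obtain a b where "X = cbox a b" using D(3)[OF \<open>X \<in> D\<close>] by blast
    then show ?thesis using box[of a b] D(2)[OF \<open>X \<in> D\<close>] by simp
  qed
  then have "AE x in lebesgue. \<forall>X\<in>D. x \<in> X \<longrightarrow> h x = 0"
    by (intro AE_ball_countable[OF D(1), THEN iffD2] ballI)
  then have "AE x in lebesgue. x \<in> U \<longrightarrow> h x = 0"
    by eventually_elim (use D(4) in blast)
  then show ?thesis using assms(1) by (simp add: AE_restrict_space_iff borel_open)
qed

section \<open>Weak gradients\<close>

lemma integrable_lebesgue_on_bounded:
  fixes f :: "'a::euclidean_space \<Rightarrow> 'b::euclidean_space"
  assumes "S \<in> lmeasurable" "f \<in> borel_measurable (lebesgue_on S)" "\<And>x. norm (f x) \<le> M"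
  shows "integrable (lebesgue_on S) f"
  using assms by (intro finite_measure.integrable_const_bound[of _ _ M] finite_measure_lebesgue_on) auto

section \<open>Integration by parts for test functions\<close>

lemma lborel_integral_translation:
  fixes f :: "'a::euclidean_space \<Rightarrow> real"
  assumes [measurable]: "f \<in> borel_measurable borel"
  shows "(\<integral>x. f (c + x) \<partial>lborel) = (\<integral>x. f x \<partial>lborel)"
    and "integrable lborel (\<lambda>x. f (c + x)) \<longleftrightarrow> integrable lborel f"
proof -
  have "(\<integral>x. f x \<partial>lborel) = (\<integral>x. f x \<partial>distr lborel borel ((+) c))"
    by (simp add: lborel_distr_plus)
  then show "(\<integral>x. f (c + x) \<partial>lborel) = (\<integral>x. f x \<partial>lborel)"
    by (simp add: integral_distr)
  have "integrable lborel f \<longleftrightarrow> integrable (distr lborel borel ((+) c)) f"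
    by (simp add: lborel_distr_plus)
  then show "integrable lborel (\<lambda>x. f (c + x)) \<longleftrightarrow> integrable lborel f"
    by (simp add: integrable_distr_eq)
qed

lemma test_functions_Lipschitz:
  assumes "\<phi> \<in> test_functions U" "\<And>x. norm (grad \<phi> x) \<le> M"
  shows "\<bar>\<phi> x - \<phi> y\<bar> \<le> M * norm (x - y)"
proof -
  have "norm (\<phi> x - \<phi> y) \<le> M * norm (x - y)"
  proof (rule differentiable_bound[of UNIV])
    show "(\<phi> has_derivative (\<lambda>h. grad \<phi> z \<bullet> h)) (at z within UNIV)" for z
      using has_derivative_grad[OF test_functions_differentiable[OF assms(1)]] by simp
    show "onorm (\<lambda>h. grad \<phi> z \<bullet> h) \<le> M" for z
    proof (rule onorm_le)
      show "norm (grad \<phi> z \<bullet> h) \<le> M * norm h" for h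
        using Cauchy_Schwarz_ineq2[of "grad \<phi> z" h] mult_right_mono[OF assms(2)[of z], of "norm h"]
        by simp
    qed
  qed auto
  then show ?thesis by simp
qed

lemma test_functions_difference_quotient:
  assumes "\<phi> \<in> test_functions U"
  shows "(\<lambda>n. real (Suc n) * (\<phi> ((1 / real (Suc n)) *\<^sub>R e + x) - \<phi> x)) \<longlonglongrightarrow> grad \<phi> x \<bullet> e"
proof -
  have "((\<lambda>t. \<phi> (t *\<^sub>R e + x)) has_derivative (\<lambda>t. grad \<phi> x \<bullet> (t *\<^sub>R e))) (at 0)"
  proof -
    have a: "((\<lambda>t. t *\<^sub>R e + x) has_derivative (\<lambda>t. t *\<^sub>R e)) (at 0)"
      by (auto intro!: derivative_eq_intros)
    have b: "(\<phi> has_derivative (\<lambda>h. grad \<phi> x \<bullet> h)) (at (0 *\<^sub>R e + x))"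
      using has_derivative_grad[OF test_functions_differentiable[OF assms]] by simp
    show ?thesis using has_derivative_compose[OF a b] .
  qed
  moreover have "(\<lambda>t. grad \<phi> x \<bullet> (t *\<^sub>R e)) = (*) (grad \<phi> x \<bullet> e)"
    by (simp add: fun_eq_iff mult.commute)
  ultimately have "((\<lambda>t. \<phi> (t *\<^sub>R e + x)) has_real_derivative (grad \<phi> x \<bullet> e)) (at 0)"
    by (simp add: has_field_derivative_def)
  then have "((\<lambda>h. (\<phi> (h *\<^sub>R e + x) - \<phi> x) / h) \<longlongrightarrow> grad \<phi> x \<bullet> e) (at 0)"
    by (simp add: DERIV_def)
  moreover have "filterlim (\<lambda>n. 1 / real (Suc n)) (at 0) sequentially"
    using LIMSEQ_inverse_real_of_nat by (auto simp: filterlim_at inverse_eq_divide)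
  ultimately have "(\<lambda>n. (\<phi> ((1 / real (Suc n)) *\<^sub>R e + x) - \<phi> x) / (1 / real (Suc n))) \<longlonglongrightarrow> grad \<phi> x \<bullet> e"
    by (rule filterlim_compose)
  then show ?thesis by (simp add: mult.commute)
qed

text \<open>By translation invariance the difference quotients of a test function integrate to zero.\<close>

lemma integral_grad_test_function:
  assumes "\<phi> \<in> test_functions U"
  shows "(\<integral>x. grad \<phi> x $ i \<partial>lebesgue) = 0"
proof -
  obtain K M where K: "compact K" "\<And>x. x \<notin> K \<Longrightarrow> \<phi> x = 0" and M: "\<And>x. \<bar>\<phi> x\<bar> \<le> M" "\<And>x. norm (grad \<phi> x) \<le> M"
    using test_functionsE[OF assms] by metis
  have M0: "M \<ge> 0" using M(1)[of 0] by linarith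
  obtain R where R: "\<And>x. x \<in> K \<Longrightarrow> norm x \<le> R"
    using compact_imp_bounded[OF K(1)] by (auto simp: bounded_iff)
  \<comment> \<open>The shift has length at most 1, so outside radius R + 1 both values in the
    difference quotient vanish. Inside, the Lipschitz bound gives the majorant M.\<close>
  let ?B = "cball (0::real^'a) (R + 1)"
  let ?e = "axis i 1 :: real ^ 'a"
  define q where "q n x = real (Suc n) * (\<phi> ((1 / real (Suc n)) *\<^sub>R ?e + x) - \<phi> x)" for n x
  have [measurable]: "\<phi> \<in> borel_measurable borel" "grad \<phi> \<in> borel_measurable borel"
    using test_functions_continuous[OF assms] test_functions_grad_continuous[OF assms]
    by (auto intro: borel_measurable_continuous_onI)
  have ib: "integrable lborel (\<lambda>x. M * indicator ?B x :: real)"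
    using emeasure_bounded_finite[of ?B] by (intro integrable_mult_right integrable_real_indicator) (auto)
  have gm: "(\<lambda>x. grad \<phi> x $ i) \<in> borel_measurable borel"
    using borel_measurable_inner[OF \<open>grad \<phi> \<in> borel_measurable borel\<close> borel_measurable_const[of ?e]]
    by (simp add: inner_axis)
  have int\<phi>: "integrable lborel \<phi>"
  proof (rule Bochner_Integration.integrable_bound[OF ib])
    have "norm (\<phi> x) \<le> norm (M * indicator ?B x :: real)" for x
      using M(1)[of x] K(2)[of x] R[of x] M0 by (cases "x \<in> K") auto
    then show "AE x in lborel. norm (\<phi> x) \<le> norm (M * indicator ?B x :: real)" by simp
  qed simp
  have "(\<lambda>n. \<integral>x. q n x \<partial>lborel) \<longlonglongrightarrow> (\<integral>x. grad \<phi> x $ i \<partial>lborel)"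
  proof (rule integral_dominated_convergence[OF _ _ ib])
    show "(\<lambda>x. grad \<phi> x $ i) \<in> borel_measurable lborel" using gm by simp
    show "q n \<in> borel_measurable lborel" for n unfolding q_def[abs_def] by measurable
    show "AE x in lborel. (\<lambda>n. q n x) \<longlonglongrightarrow> grad \<phi> x $ i"
      using test_functions_difference_quotient[OF assms, of ?e] by (simp add: q_def inner_axis)
    have "norm (q n x) \<le> M * indicator ?B x" for n x
    proof (cases "x \<in> ?B")
      case True
      have "\<bar>\<phi> ((1 / real (Suc n)) *\<^sub>R ?e + x) - \<phi> x\<bar> \<le> M * (1 / real (Suc n))"
        using test_functions_Lipschitz[OF assms M(2), of "(1 / real (Suc n)) *\<^sub>R ?e + x" x] by simp
      then have "real (Suc n) * \<bar>\<phi> ((1 / real (Suc n)) *\<^sub>R ?e + x) - \<phi> x\<bar> \<le> real (Suc n) * (M * (1 / real (Suc n)))"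
        by (intro mult_left_mono) auto
      then show ?thesis using True by (simp add: q_def abs_mult)
    next
      case False
      then have x: "norm x > R + 1" by simp
      have "norm ((1 / real (Suc n)) *\<^sub>R ?e) \<le> 1" by simp
      then have "norm ((1 / real (Suc n)) *\<^sub>R ?e + x) > R"
        using x norm_diff_ineq[of x "(1 / real (Suc n)) *\<^sub>R ?e"]
        unfolding add.commute[of _ x] by linarith
      then have "\<phi> ((1 / real (Suc n)) *\<^sub>R ?e + x) = 0" "\<phi> x = 0"
        using R[of x] R[of "(1 / real (Suc n)) *\<^sub>R ?e + x"] x by (auto intro!: K(2))
      then show ?thesis using False by (simp add: q_def)
    qed
    then show "AE x in lborel. norm (q n x) \<le> M * indicator ?B x" for n by simp
  qed
  moreover have "(\<integral>x. q n x \<partial>lborel) = 0" for n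
    using int\<phi> by (simp add: q_def lborel_integral_translation)
  ultimately have "(\<integral>x. grad \<phi> x $ i \<partial>lborel) = 0"
    using LIMSEQ_unique[of "\<lambda>n. 0::real"] by fastforce
  then show ?thesis using gm by (simp add: integral_completion)
qed

lemma test_functions_mult:
  assumes "\<phi> \<in> test_functions U" "\<psi> \<in> test_functions U"
  shows "(\<lambda>x. \<phi> x * \<psi> x) \<in> test_functions U"
proof -
  obtain K M where "compact K" "K \<subseteq> U" "\<And>x. x \<notin> K \<Longrightarrow> \<phi> x = 0"
    using test_functionsE[OF assms(1)] by metis
  then show ?thesis
    by (intro test_functionsI[of _ K] Ck_mult) (auto intro: assms[THEN test_functions_Ck])
qed

lemma integrable_test_function_products:
  fixes \<phi> :: "real ^ 'n \<Rightarrow> real"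
  assumes "\<phi> \<in> test_functions U" "locally_integrable U f" "U \<in> sets lebesgue"
  shows "integrable (lebesgue_on U) (\<lambda>x. f x * \<phi> x)"
    "integrable (lebesgue_on U) (\<lambda>x. f x * grad \<phi> x $ i)"
proof -
  obtain K M where K: "compact K" "K \<subseteq> U" "\<And>x. x \<notin> K \<Longrightarrow> \<phi> x = 0" "\<And>x. x \<notin> K \<Longrightarrow> grad \<phi> x = 0"
    and M: "\<And>x. \<bar>\<phi> x\<bar> \<le> M" "\<And>x. norm (grad \<phi> x) \<le> M"
    using test_functionsE[OF assms(1)] by metis
  have m: "\<phi> \<in> borel_measurable lebesgue" "grad \<phi> \<in> borel_measurable lebesgue"
    using test_functions_measurable[OF assms(1), where S=UNIV] by (simp_all add: lebesgue_on_UNIV_eq)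
  have "(\<lambda>x. grad \<phi> x $ i) \<in> borel_measurable lebesgue"
    using borel_measurable_inner[OF m(2) borel_measurable_const[of "axis i 1"]] by (simp add: inner_axis)
  moreover have "\<bar>grad \<phi> x $ i\<bar> \<le> M" for x
    using M(2)[of x] component_le_norm_cart[of "grad \<phi> x" i] by linarith
  ultimately show "integrable (lebesgue_on U) (\<lambda>x. f x * \<phi> x)"
    "integrable (lebesgue_on U) (\<lambda>x. f x * grad \<phi> x $ i)"
    using K m M by (auto intro!: integrable_locally_integrable_mult[OF assms(2,3) K(1,2)])
qed

lemma locally_integrable_bounded:
  fixes f :: "real ^ 'n \<Rightarrow> 'b :: euclidean_space"
  assumes "\<And>S. f \<in> borel_measurable (lebesgue_on S)" "\<And>x. norm (f x) \<le> M"
  shows "locally_integrable U f"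
  unfolding locally_integrable_def
proof (intro allI impI)
  fix K assume "compact K \<and> K \<subseteq> U"
  then show "integrable (lebesgue_on K) f"
    using assms by (intro integrable_lebesgue_on_bounded[where M=M] lmeasurable_compact) auto
qed

text \<open>Integration by parts: the product \<phi> \<psi> is again a test function, so its
  gradient integrates to zero.\<close>

lemma has_weak_grad_test_function:
  assumes "\<phi> \<in> test_functions U" "U \<in> sets lebesgue"
  shows "has_weak_grad U \<phi> (grad \<phi>)"
  unfolding has_weak_grad_def
proof (intro conjI ballI allI)
  obtain K M where M: "\<And>x. \<bar>\<phi> x\<bar> \<le> M" "\<And>x. norm (grad \<phi> x) \<le> M"
    using test_functionsE[OF assms(1)] by metis
  show li: "locally_integrable U \<phi>" "locally_integrable U (grad \<phi>)"
    using M test_functions_measurable[OF assms(1)] by (auto intro: locally_integrable_bounded[where M=M])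
  fix \<psi> :: "real ^ 'a \<Rightarrow> real" and i assume \<psi>: "\<psi> \<in> test_functions U"
  obtain L N where L: "L \<subseteq> U" "\<And>x. x \<notin> L \<Longrightarrow> \<psi> x = 0" "\<And>x. x \<notin> L \<Longrightarrow> grad \<psi> x = 0" and N: "\<And>x. \<bar>\<psi> x\<bar> \<le> N"
    using test_functionsE[OF \<psi>] by metis
  have li': "locally_integrable U \<psi>"
    using N test_functions_measurable[OF \<psi>] by (auto intro: locally_integrable_bounded[where M=N])
  \<comment> \<open>The indicator is harmless because \<psi> and its gradient vanish off U; it turns
    the integral over the whole space into one over U.\<close>
  have "(\<lambda>x. grad (\<lambda>x. \<phi> x * \<psi> x) x $ i) = (\<lambda>x. indicator U x *\<^sub>R (\<phi> x * grad \<psi> x $ i + \<psi> x * grad \<phi> x $ i))"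
  proof
    fix x
    show "grad (\<lambda>x. \<phi> x * \<psi> x) x $ i = indicator U x *\<^sub>R (\<phi> x * grad \<psi> x $ i + \<psi> x * grad \<phi> x $ i)"
      using L(1) L(2,3)[of x]
      by (cases "x \<in> L") (auto simp: grad_mult test_functions_differentiable[OF assms(1)]
        test_functions_differentiable[OF \<psi>])
  qed
  then have "(\<integral>x. \<phi> x * grad \<psi> x $ i + \<psi> x * grad \<phi> x $ i \<partial>lebesgue_on U) = 0"
    using integral_grad_test_function[OF test_functions_mult[OF assms(1) \<psi>], of i] assms(2)
    by (simp add: integral_lebesgue_on)
  moreover have "integrable (lebesgue_on U) (\<lambda>x. \<phi> x * grad \<psi> x $ i)" "integrable (lebesgue_on U) (\<lambda>x. \<psi> x * grad \<phi> x $ i)"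
    using integrable_test_function_products(2)[OF \<psi> li(1) assms(2)]
      integrable_test_function_products(2)[OF assms(1) li' assms(2)] by auto
  ultimately show "(\<integral>x. \<phi> x * grad \<psi> x $ i \<partial>lebesgue_on U) = - (\<integral>x. grad \<phi> x $ i * \<psi> x \<partial>lebesgue_on U)"
    by (simp add: mult.commute)
qed

lemma locally_integrable_component:
  "locally_integrable U f \<Longrightarrow> locally_integrable U (\<lambda>x. f x $ i)" for f :: "real ^ 'n \<Rightarrow> real ^ 'm"
  unfolding locally_integrable_def
  using integrable_inner_left[of "axis i 1 :: real ^ 'm"] by (fastforce simp: inner_axis)

lemma locally_integrable_diff:
  "locally_integrable U f \<Longrightarrow> locally_integrable U g \<Longrightarrow> locally_integrable U (\<lambda>x. f x - g x)"
  by (auto simp: locally_integrable_def)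

section \<open>Linearity and uniqueness of weak gradients\<close>

lemma has_weak_grad_diff:
  assumes "has_weak_grad U u Du" "has_weak_grad U v Dv" "U \<in> sets lebesgue"
  shows "has_weak_grad U (\<lambda>x. u x - v x) (\<lambda>x. Du x - Dv x)"
  unfolding has_weak_grad_def
proof (intro conjI ballI allI)
  show "locally_integrable U (\<lambda>x. u x - v x)" "locally_integrable U (\<lambda>x. Du x - Dv x)"
    using assms by (auto simp: has_weak_grad_def intro: locally_integrable_diff)
  fix \<phi> :: "real ^ 'a \<Rightarrow> real" and i assume \<phi>: "\<phi> \<in> test_functions U"
  note i = integrable_test_function_products[OF \<phi> _ assms(3)]
  show "(\<integral>x. (u x - v x) * grad \<phi> x $ i \<partial>lebesgue_on U) = - (\<integral>x. (Du x - Dv x) $ i * \<phi> x \<partial>lebesgue_on U)"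
    using assms \<phi> i(2)[of u i] i(2)[of v i] i(1)[of "\<lambda>x. Du x $ i"] i(1)[of "\<lambda>x. Dv x $ i"]
    by (simp add: has_weak_grad_def left_diff_distrib locally_integrable_component)
qed

text \<open>Each component of the difference of two weak gradients is orthogonal to all test
  functions. This is the bridge from the chosen \<open>weak_grad U u\<close> to any explicitly known
  weak gradient.\<close>

lemma has_weak_grad_unique:
  assumes "has_weak_grad U u D" "has_weak_grad U u D'" "open U"
  shows "AE x in lebesgue_on U. D x = D' x"
proof -
  have U: "U \<in> sets lebesgue" using assms(3) by (simp add: borel_open)
  have "AE x in lebesgue_on U. D x $ i - D' x $ i = 0" for i
  proof (rule fundamental_lemma_of_calculus_of_variations[OF assms(3)])
    have li: "locally_integrable U (\<lambda>x. D x $ i)" "locally_integrable U (\<lambda>x. D' x $ i)"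
      using assms by (auto simp: has_weak_grad_def intro: locally_integrable_component)
    then show "locally_integrable U (\<lambda>x. D x $ i - D' x $ i)" by (rule locally_integrable_diff)
    fix \<phi> :: "real ^ 'a \<Rightarrow> real" assume \<phi>: "\<phi> \<in> test_functions U"
    have "(\<integral>x. u x * grad \<phi> x $ i \<partial>lebesgue_on U) = - (\<integral>x. D x $ i * \<phi> x \<partial>lebesgue_on U)"
      "(\<integral>x. u x * grad \<phi> x $ i \<partial>lebesgue_on U) = - (\<integral>x. D' x $ i * \<phi> x \<partial>lebesgue_on U)"
      using assms(1,2) \<phi> unfolding has_weak_grad_def by blast+
    then have "(\<integral>x. D x $ i * \<phi> x \<partial>lebesgue_on U) = (\<integral>x. D' x $ i * \<phi> x \<partial>lebesgue_on U)"
      by linarith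
    then show "(\<integral>x. (D x $ i - D' x $ i) * \<phi> x \<partial>lebesgue_on U) = 0"
      using integrable_test_function_products(1)[OF \<phi> li(1) U] integrable_test_function_products(1)[OF \<phi> li(2) U]
      by (simp add: left_diff_distrib)
  qed
  then have "AE x in lebesgue_on U. \<forall>i\<in>UNIV. D x $ i - D' x $ i = 0"
    by (intro AE_finite_allI) auto
  then show ?thesis by eventually_elim (simp add: vec_eq_iff)
qed

section \<open>Square integrable functions and approximation by test functions\<close>

lemma in_L2_iff:
  "in_Lp 2 U f \<longleftrightarrow> f \<in> borel_measurable (lebesgue_on U) \<and> integrable (lebesgue_on U) (\<lambda>x. (norm (f x))\<^sup>2)"
  by (simp add: in_Lp_def)

lemma Lp_norm_2: "Lp_norm 2 U f = sqrt (\<integral>x. (norm (f x))\<^sup>2 \<partial>lebesgue_on U)"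
  by (simp add: Lp_norm_def powr_half_sqrt)

lemma Lp_norm_2_sq: "(Lp_norm 2 U f)\<^sup>2 = (\<integral>x. (norm (f x))\<^sup>2 \<partial>lebesgue_on U)"
  by (simp add: Lp_norm_2)

section \<open>The Cauchy-Schwarz inequality and differences of square integrable functions\<close>

lemma integrable_norm_mult_norm:
  fixes f :: "'a \<Rightarrow> 'b::{banach,second_countable_topology}" and g :: "'a \<Rightarrow> 'c::{banach,second_countable_topology}"
  assumes "f \<in> borel_measurable M" "g \<in> borel_measurable M"
    and "integrable M (\<lambda>x. (norm (f x))\<^sup>2)" "integrable M (\<lambda>x. (norm (g x))\<^sup>2)"
  shows "integrable M (\<lambda>x. norm (f x) * norm (g x))"
proof (rule Bochner_Integration.integrable_bound)
  show "integrable M (\<lambda>x. (norm (f x))\<^sup>2 + (norm (g x))\<^sup>2)" using assms by simp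
  show "(\<lambda>x. norm (f x) * norm (g x)) \<in> borel_measurable M" using assms by simp
  have "norm (norm (f x) * norm (g x)) \<le> norm ((norm (f x))\<^sup>2 + (norm (g x))\<^sup>2)" for x
  proof -
    have "0 \<le> norm (f x) * norm (g x)" "0 \<le> (norm (f x))\<^sup>2 + (norm (g x))\<^sup>2" by simp_all
    then show ?thesis
      using sum_squares_bound[of "norm (f x)" "norm (g x)"] unfolding real_norm_def by linarith
  qed
  then show "AE x in M. norm (norm (f x) * norm (g x)) \<le> norm ((norm (f x))\<^sup>2 + (norm (g x))\<^sup>2)" by simp
qed

text \<open>The discriminant argument: integrating (t |f| - |g|)^2 gives a nonnegative quadratic
  polynomial in t, whose minimiser is I / A. The case A = 0 is separate because there is no such
  minimiser.\<close>

lemma integral_norm_mult_norm_le: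
  fixes f :: "'a \<Rightarrow> 'b::{banach,second_countable_topology}" and g :: "'a \<Rightarrow> 'c::{banach,second_countable_topology}"
  assumes "f \<in> borel_measurable M" "g \<in> borel_measurable M"
    and "integrable M (\<lambda>x. (norm (f x))\<^sup>2)" "integrable M (\<lambda>x. (norm (g x))\<^sup>2)"
  shows "(\<integral>x. norm (f x) * norm (g x) \<partial>M) \<le> sqrt (\<integral>x. (norm (f x))\<^sup>2 \<partial>M) * sqrt (\<integral>x. (norm (g x))\<^sup>2 \<partial>M)"
proof -
  define A B I where "A = (\<integral>x. (norm (f x))\<^sup>2 \<partial>M)" and "B = (\<integral>x. (norm (g x))\<^sup>2 \<partial>M)"
    and "I = (\<integral>x. norm (f x) * norm (g x) \<partial>M)"
  have pos: "A \<ge> 0" "I \<ge> 0" by (auto simp: A_def I_def)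
  have q: "0 \<le> t\<^sup>2 * A - 2 * t * I + B" for t
  proof -
    have "0 \<le> (\<integral>x. (t * norm (f x) - norm (g x))\<^sup>2 \<partial>M)" by simp
    also have "\<dots> = (\<integral>x. t\<^sup>2 * (norm (f x))\<^sup>2 - 2 * t * (norm (f x) * norm (g x)) + (norm (g x))\<^sup>2 \<partial>M)"
      by (intro Bochner_Integration.integral_cong refl) (simp add: power2_diff power_mult_distrib)
    also have "\<dots> = t\<^sup>2 * A - 2 * t * I + B"
      using assms integrable_norm_mult_norm[OF assms] by (simp add: A_def B_def I_def)
    finally show ?thesis .
  qed
  have "I\<^sup>2 \<le> A * B"
  proof (cases "A = 0")
    case True
    have "I = 0"
    proof (rule ccontr)
      assume "I \<noteq> 0"
      \<comment> \<open>With A = 0 the polynomial is linear in t, and this t gives it the value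
        -1.\<close>
      then show False using q[of "(B + 1) / (2 * I)"] True by (simp add: field_simps)
    qed
    then show ?thesis using True by simp
  next
    case False
    then have "A > 0" using pos by simp
    then have "0 \<le> B - I\<^sup>2 / A"
      using q[of "I / A"] by (simp add: power2_eq_square field_simps)
    then show ?thesis using \<open>A > 0\<close> by (simp add: field_simps)
  qed
  then show ?thesis
    unfolding A_def[symmetric] B_def[symmetric] I_def[symmetric]
    by (simp add: real_le_rsqrt flip: real_sqrt_mult)
qed

lemma in_L2_norm_mult:
  assumes "in_Lp 2 U f" "in_Lp 2 U g"
  shows "integrable (lebesgue_on U) (\<lambda>x. norm (f x) * norm (g x))"
    "(\<integral>x. norm (f x) * norm (g x) \<partial>lebesgue_on U) \<le> Lp_norm 2 U f * Lp_norm 2 U g"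
  using assms integrable_norm_mult_norm[of f "lebesgue_on U" g] integral_norm_mult_norm_le[of f "lebesgue_on U" g]
  by (auto simp: in_L2_iff Lp_norm_2)

lemma in_L2_inner:
  assumes "in_Lp 2 U f" "in_Lp 2 U g"
  shows "integrable (lebesgue_on U) (\<lambda>x. f x \<bullet> g x)"
proof (rule Bochner_Integration.integrable_bound[OF in_L2_norm_mult(1)[OF assms]])
  show "(\<lambda>x. f x \<bullet> g x) \<in> borel_measurable (lebesgue_on U)"
    using assms by (auto simp: in_L2_iff)
  show "AE x in lebesgue_on U. norm (f x \<bullet> g x) \<le> norm (norm (f x) * norm (g x))"
    using Cauchy_Schwarz_ineq2 by (auto simp: abs_mult)
qed

lemma norm_diff_sq_le:
  fixes x y :: "'a::real_normed_vector"
  shows "(norm (x - y))\<^sup>2 \<le> 2 * (norm x)\<^sup>2 + 2 * (norm y)\<^sup>2"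
proof -
  have "(norm (x - y))\<^sup>2 \<le> (norm x + norm y)\<^sup>2"
    by (intro power_mono norm_triangle_ineq4) auto
  then show ?thesis
    using sum_squares_bound[of "norm x" "norm y"] by (simp add: power2_sum)
qed

lemma in_L2_diff:
  assumes "in_Lp 2 U f" "in_Lp 2 U g"
  shows "in_Lp 2 U (\<lambda>x. f x - g x)"
  unfolding in_L2_iff
proof
  show m: "(\<lambda>x. f x - g x) \<in> borel_measurable (lebesgue_on U)"
    using assms by (auto simp: in_L2_iff)
  show "integrable (lebesgue_on U) (\<lambda>x. (norm (f x - g x))\<^sup>2)"
  proof (rule Bochner_Integration.integrable_bound)
    show "integrable (lebesgue_on U) (\<lambda>x. 2 * (norm (f x))\<^sup>2 + 2 * (norm (g x))\<^sup>2)"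
      using assms by (auto simp: in_L2_iff)
    show "(\<lambda>x. (norm (f x - g x))\<^sup>2) \<in> borel_measurable (lebesgue_on U)"
      using m by simp
    show "AE x in lebesgue_on U. norm ((norm (f x - g x))\<^sup>2) \<le> norm (2 * (norm (f x))\<^sup>2 + 2 * (norm (g x))\<^sup>2)"
      using norm_diff_sq_le by (auto intro!: AE_I2 simp: abs_of_nonneg)
  qed
qed

lemma integral_norm_diff_sq_le:
  assumes "in_Lp 2 U f" "in_Lp 2 U g"
  shows "(\<integral>x. (norm (f x - g x))\<^sup>2 \<partial>lebesgue_on U)
    \<le> 2 * (\<integral>x. (norm (f x))\<^sup>2 \<partial>lebesgue_on U) + 2 * (\<integral>x. (norm (g x))\<^sup>2 \<partial>lebesgue_on U)"
proof -
  have "(\<integral>x. (norm (f x - g x))\<^sup>2 \<partial>lebesgue_on U)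
      \<le> (\<integral>x. 2 * (norm (f x))\<^sup>2 + 2 * (norm (g x))\<^sup>2 \<partial>lebesgue_on U)"
    using in_L2_diff[OF assms] assms by (intro integral_mono norm_diff_sq_le) (auto simp: in_L2_iff)
  then show ?thesis using assms by (simp add: in_L2_iff)
qed

lemma in_L2_bounded:
  assumes "U \<in> lmeasurable" "f \<in> borel_measurable (lebesgue_on U)" "\<And>x. norm (f x) \<le> M"
  shows "in_Lp 2 U f"
  unfolding in_L2_iff
proof
  have "norm ((norm (f x))\<^sup>2) \<le> M\<^sup>2" for x using assms(3)[of x] by (simp add: power_mono)
  then show "integrable (lebesgue_on U) (\<lambda>x. (norm (f x))\<^sup>2)"
    using assms by (intro integrable_lebesgue_on_bounded[where M="M\<^sup>2"]) auto
qed (rule assms)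

lemma in_L2_test_function:
  assumes "\<phi> \<in> test_functions U" "U \<in> lmeasurable"
  shows "in_Lp 2 U \<phi>" "in_Lp 2 U (grad \<phi>)"
proof -
  obtain M where "\<And>x. \<bar>\<phi> x\<bar> \<le> M" "\<And>x. norm (grad \<phi> x) \<le> M"
    using test_functionsE[OF assms(1)] by metis
  then show "in_Lp 2 U \<phi>" "in_Lp 2 U (grad \<phi>)"
    using assms test_functions_measurable[OF assms(1)] by (auto intro: in_L2_bounded[where M=M])
qed

section \<open>Independence of the chosen weak gradient\<close>

lemma borel_measurable_lebesgue_on_AE:
  fixes f g :: "'a::euclidean_space \<Rightarrow> 'b::euclidean_space"
  assumes "f \<in> borel_measurable (lebesgue_on U)" "AE x in lebesgue_on U. f x = g x" "U \<in> sets lebesgue"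
  shows "g \<in> borel_measurable (lebesgue_on U)"
proof -
  have "(\<lambda>x. if x \<in> U then f x else 0) \<in> borel_measurable lebesgue"
    using assms by (simp add: borel_measurable_if)
  moreover have "AE x in lebesgue. x \<in> U \<longrightarrow> f x = g x"
    using assms by (simp add: AE_restrict_space_iff)
  then have "AE x in lebesgue. (if x \<in> U then f x else 0) = (if x \<in> U then g x else 0)"
    by eventually_elim simp
  ultimately have "(\<lambda>x. if x \<in> U then g x else 0) \<in> borel_measurable lebesgue"
    by (rule borel_measurable_AE)
  then show ?thesis using assms by (simp add: borel_measurable_if)
qed

lemma in_L2_cong_AE:
  assumes "in_Lp 2 U f" "AE x in lebesgue_on U. f x = g x" "U \<in> sets lebesgue"
  shows "in_Lp 2 U g"
    "(\<integral>x. (norm (g x))\<^sup>2 \<partial>lebesgue_on U) = (\<integral>x. (norm (f x))\<^sup>2 \<partial>lebesgue_on U)"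
proof -
  have m: "f \<in> borel_measurable (lebesgue_on U)" using assms by (simp add: in_L2_iff)
  have m': "g \<in> borel_measurable (lebesgue_on U)"
    by (rule borel_measurable_lebesgue_on_AE[OF m assms(2,3)])
  have ae: "AE x in lebesgue_on U. (norm (f x))\<^sup>2 = (norm (g x))\<^sup>2"
    using assms(2) by eventually_elim simp
  then show "(\<integral>x. (norm (g x))\<^sup>2 \<partial>lebesgue_on U) = (\<integral>x. (norm (f x))\<^sup>2 \<partial>lebesgue_on U)"
    using m m' by (intro integral_cong_AE) (auto elim: eventually_mono)
  have "integrable (lebesgue_on U) (\<lambda>x. (norm (g x))\<^sup>2)"
    by (rule Bochner_Integration.integrable_cong_AE_imp[OF _ _ ae]) (use assms m' in \<open>auto simp: in_L2_iff\<close>)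
  then show "in_Lp 2 U g" using m' by (simp add: in_L2_iff)
qed

lemma weak_grad_AE_eq:
  assumes "has_weak_grad U u D" "open U"
  shows "AE x in lebesgue_on U. D x = weak_grad U u x"
proof -
  have "has_weak_grad U u (weak_grad U u)"
    unfolding weak_grad_def using someI[where P="has_weak_grad U u"] assms(1) by blast
  then show ?thesis using has_weak_grad_unique assms by blast
qed

lemma sum_Lp_norm_2_component_sq:
  fixes f :: "real ^ 'n \<Rightarrow> real ^ 'm"
  assumes "in_Lp 2 U f"
  shows "(\<Sum>i\<in>UNIV. (Lp_norm 2 U (\<lambda>x. f x $ i))\<^sup>2) = (\<integral>x. (norm (f x))\<^sup>2 \<partial>lebesgue_on U)"
proof -
  have "integrable (lebesgue_on U) (\<lambda>x. (f x $ i)\<^sup>2)" for i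
  proof (rule Bochner_Integration.integrable_bound)
    show "integrable (lebesgue_on U) (\<lambda>x. (norm (f x))\<^sup>2)" using assms by (simp add: in_L2_iff)
    have "(\<lambda>x. f x \<bullet> axis i 1) \<in> borel_measurable (lebesgue_on U)"
      using assms by (auto simp: in_L2_iff)
    then show "(\<lambda>x. (f x $ i)\<^sup>2) \<in> borel_measurable (lebesgue_on U)" by (simp add: inner_axis)
    have "(f x $ i)\<^sup>2 \<le> (norm (f x))\<^sup>2" for x
      using component_le_norm_cart[of "f x" i] abs_le_square_iff[of "f x $ i" "norm (f x)"] by simp
    then show "AE x in lebesgue_on U. norm ((f x $ i)\<^sup>2) \<le> norm ((norm (f x))\<^sup>2)" by simp
  qed
  then have "(\<Sum>i\<in>UNIV. (Lp_norm 2 U (\<lambda>x. f x $ i))\<^sup>2) = (\<integral>x. (\<Sum>i\<in>UNIV. (f x $ i)\<^sup>2) \<partial>lebesgue_on U)"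
    by (simp add: Lp_norm_2_sq)
  moreover have "(\<Sum>i\<in>UNIV. (f x $ i)\<^sup>2) = (norm (f x))\<^sup>2" for x
    unfolding power2_norm_eq_inner by (simp add: inner_vec_def power2_eq_square)
  ultimately show ?thesis by simp
qed

text \<open>D may be any square integrable version of the weak gradient. Hence the norm of u -
  \<phi> can be computed from \<open>weak_grad U u\<close> and the classical gradient of
  \<phi>.\<close>

lemma H12_norm_sq:
  assumes "has_weak_grad U u D" "in_Lp 2 U D" "open U"
  shows "(H12_norm U u)\<^sup>2 = (\<integral>x. (u x)\<^sup>2 \<partial>lebesgue_on U) + (\<integral>x. (norm (D x))\<^sup>2 \<partial>lebesgue_on U)"
proof -
  have U: "U \<in> sets lebesgue" using assms(3) by (simp add: borel_open)
  note c = in_L2_cong_AE[OF assms(2) weak_grad_AE_eq[OF assms(1,3)] U]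
  have "(H12_norm U u)\<^sup>2 = (Lp_norm 2 U u)\<^sup>2 + (\<Sum>i\<in>UNIV. (Lp_norm 2 U (\<lambda>x. weak_grad U u x $ i))\<^sup>2)"
    by (simp add: H12_norm_def sum_nonneg)
  then show ?thesis unfolding sum_Lp_norm_2_component_sq[OF c(1)] c(2) by (simp add: Lp_norm_2_sq)
qed

text \<open>Membership of \<open>w\<close> in \<open>H12_0 U\<close> with the weak gradient \<open>W\<close> made explicit, so that
  differences need no choice of a weak gradient.\<close>

definition test_approx :: "(real ^ 'n) set \<Rightarrow> (real ^ 'n \<Rightarrow> real) \<Rightarrow> (real ^ 'n \<Rightarrow> real ^ 'n) \<Rightarrow> bool" where
  "test_approx U w W \<longleftrightarrow> in_Lp 2 U w \<and> in_Lp 2 U W \<and>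
     (\<exists>\<phi>. (\<forall>n. \<phi> n \<in> test_functions U) \<and>
       (\<lambda>n. \<integral>x. (norm (w x - \<phi> n x))\<^sup>2 \<partial>lebesgue_on U) \<longlonglongrightarrow> 0 \<and>
       (\<lambda>n. \<integral>x. (norm (W x - grad (\<phi> n) x))\<^sup>2 \<partial>lebesgue_on U) \<longlonglongrightarrow> 0)"

lemma H12_0_weak_grad:
  assumes "u \<in> H12_0 U" "open U"
  shows "in_Lp 2 U u" "has_weak_grad U u (weak_grad U u)" "in_Lp 2 U (weak_grad U u)"
proof -
  have U: "U \<in> sets lebesgue" using assms(2) by (simp add: borel_open)
  obtain D where D: "in_Lp 2 U u" "has_weak_grad U u D" "in_Lp 2 U D"
    using assms(1) by (auto simp: H12_0_def H12_def)
  show "in_Lp 2 U u" by fact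
  show "has_weak_grad U u (weak_grad U u)"
    unfolding weak_grad_def using someI[where P="has_weak_grad U u"] D(2) by blast
  show "in_Lp 2 U (weak_grad U u)"
    by (rule in_L2_cong_AE(1)[OF D(3) weak_grad_AE_eq[OF D(2) assms(2)] U])
qed

lemma H12_0_test_approx:
  assumes "u \<in> H12_0 U" "open U" "bounded U"
  shows "test_approx U u (weak_grad U u)"
proof -
  have U: "U \<in> sets lebesgue" "U \<in> lmeasurable"
    using assms by (auto simp: borel_open lmeasurable_open)
  note D = H12_0_weak_grad[OF assms(1,2)]
  have "\<forall>n. \<exists>\<phi>\<in>test_functions U. H12_norm U (\<lambda>x. u x - \<phi> x) < inverse (real (Suc n))"
    using assms(1) by (auto simp: H12_0_def)
  then obtain \<phi> where \<phi>: "\<And>n. \<phi> n \<in> test_functions U"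
    and lt: "\<And>n. H12_norm U (\<lambda>x. u x - \<phi> n x) < inverse (real (Suc n))"
    by metis
  define a b where "a n = (\<integral>x. (norm (u x - \<phi> n x))\<^sup>2 \<partial>lebesgue_on U)"
    and "b n = (\<integral>x. (norm (weak_grad U u x - grad (\<phi> n) x))\<^sup>2 \<partial>lebesgue_on U)" for n
  have ab: "a n + b n \<le> inverse (real (Suc n)) ^ 2" for n
  proof -
    have "(H12_norm U (\<lambda>x. u x - \<phi> n x))\<^sup>2 = a n + b n"
      unfolding a_def b_def real_norm_def power2_abs
      by (intro H12_norm_sq has_weak_grad_diff has_weak_grad_test_function in_L2_diff
        in_L2_test_function \<phi> D U assms)
    moreover have "0 \<le> H12_norm U (\<lambda>x. u x - \<phi> n x)"
      by (simp add: H12_norm_def sum_nonneg)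
    ultimately show ?thesis using lt[of n] by (metis less_imp_le power_mono)
  qed
  have pos: "a n \<ge> 0" "b n \<ge> 0" for n by (auto simp: a_def b_def)
  have lim: "(\<lambda>n. inverse (real (Suc n)) ^ 2) \<longlonglongrightarrow> 0"
    using tendsto_power[OF LIMSEQ_inverse_real_of_nat, of 2] by simp
  have "a n \<le> inverse (real (Suc n)) ^ 2" "b n \<le> inverse (real (Suc n)) ^ 2" for n
    using ab[of n] pos[of n] by linarith+
  then have "a \<longlonglongrightarrow> 0" "b \<longlonglongrightarrow> 0"
    using pos by (auto intro!: tendsto_sandwich[OF _ _ tendsto_const lim] always_eventually)
  then show ?thesis
    using D \<phi> unfolding test_approx_def a_def b_def by blast
qed

lemma test_approx_diff:
  assumes "test_approx U u D" "test_approx U v E" "U \<in> lmeasurable"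
  shows "test_approx U (\<lambda>x. u x - v x) (\<lambda>x. D x - E x)"
proof -
  obtain \<phi> where \<phi>: "\<And>n. \<phi> n \<in> test_functions U"
      "(\<lambda>n. \<integral>x. (norm (u x - \<phi> n x))\<^sup>2 \<partial>lebesgue_on U) \<longlonglongrightarrow> 0"
      "(\<lambda>n. \<integral>x. (norm (D x - grad (\<phi> n) x))\<^sup>2 \<partial>lebesgue_on U) \<longlonglongrightarrow> 0"
    using assms(1) unfolding test_approx_def by blast
  obtain \<psi> where \<psi>: "\<And>n. \<psi> n \<in> test_functions U"
      "(\<lambda>n. \<integral>x. (norm (v x - \<psi> n x))\<^sup>2 \<partial>lebesgue_on U) \<longlonglongrightarrow> 0"
      "(\<lambda>n. \<integral>x. (norm (E x - grad (\<psi> n) x))\<^sup>2 \<partial>lebesgue_on U) \<longlonglongrightarrow> 0"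
    using assms(2) unfolding test_approx_def by blast
  have L: "in_Lp 2 U u" "in_Lp 2 U D" "in_Lp 2 U v" "in_Lp 2 U E"
    using assms by (auto simp: test_approx_def)
  have gd: "grad (\<lambda>x. \<phi> n x - \<psi> n x) x = grad (\<phi> n) x - grad (\<psi> n) x" for n x
    using grad_eqI[OF has_derivative_diff[OF has_derivative_grad[OF test_functions_differentiable[OF \<phi>(1)]]
      has_derivative_grad[OF test_functions_differentiable[OF \<psi>(1)]]]]
    by (simp add: vec_eq_iff inner_axis)
  have lim: "(\<lambda>n. 2 * p n + 2 * q n) \<longlonglongrightarrow> 0" if "p \<longlonglongrightarrow> 0" "q \<longlonglongrightarrow> 0" for p q :: "nat \<Rightarrow> real"
    using tendsto_add[OF tendsto_mult_left[OF that(1), of 2] tendsto_mult_left[OF that(2), of 2]] by simp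
  have 1: "(\<lambda>n. \<integral>x. (norm (u x - v x - (\<phi> n x - \<psi> n x)))\<^sup>2 \<partial>lebesgue_on U) \<longlonglongrightarrow> 0"
  proof (rule tendsto_sandwich[OF _ _ tendsto_const lim[OF \<phi>(2) \<psi>(2)]])
    have "(\<integral>x. (norm (u x - v x - (\<phi> n x - \<psi> n x)))\<^sup>2 \<partial>lebesgue_on U)
      = (\<integral>x. (norm ((u x - \<phi> n x) - (v x - \<psi> n x)))\<^sup>2 \<partial>lebesgue_on U)" for n
      by (simp add: algebra_simps)
    then show "\<forall>\<^sub>F n in sequentially. (\<integral>x. (norm (u x - v x - (\<phi> n x - \<psi> n x)))\<^sup>2 \<partial>lebesgue_on U)
      \<le> 2 * (\<integral>x. (norm (u x - \<phi> n x))\<^sup>2 \<partial>lebesgue_on U) + 2 * (\<integral>x. (norm (v x - \<psi> n x))\<^sup>2 \<partial>lebesgue_on U)"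
      by (simp only:) (intro always_eventually allI integral_norm_diff_sq_le in_L2_diff L in_L2_test_function \<phi> \<psi> assms)
  qed simp
  have 2: "(\<lambda>n. \<integral>x. (norm (D x - E x - (grad (\<phi> n) x - grad (\<psi> n) x)))\<^sup>2 \<partial>lebesgue_on U) \<longlonglongrightarrow> 0"
  proof (rule tendsto_sandwich[OF _ _ tendsto_const lim[OF \<phi>(3) \<psi>(3)]])
    have "(\<integral>x. (norm (D x - E x - (grad (\<phi> n) x - grad (\<psi> n) x)))\<^sup>2 \<partial>lebesgue_on U)
      = (\<integral>x. (norm ((D x - grad (\<phi> n) x) - (E x - grad (\<psi> n) x)))\<^sup>2 \<partial>lebesgue_on U)" for n
      by (simp add: algebra_simps)
    then show "\<forall>\<^sub>F n in sequentially. (\<integral>x. (norm (D x - E x - (grad (\<phi> n) x - grad (\<psi> n) x)))\<^sup>2 \<partial>lebesgue_on U)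
      \<le> 2 * (\<integral>x. (norm (D x - grad (\<phi> n) x))\<^sup>2 \<partial>lebesgue_on U) + 2 * (\<integral>x. (norm (E x - grad (\<psi> n) x))\<^sup>2 \<partial>lebesgue_on U)"
      by (simp only:) (intro always_eventually allI integral_norm_diff_sq_le in_L2_diff L in_L2_test_function \<phi> \<psi> assms)
  qed simp
  show ?thesis
    unfolding test_approx_def
    using 1 2 test_functions_diff[OF \<phi>(1) \<psi>(1)] in_L2_diff[OF L(1,3)] in_L2_diff[OF L(2,4)]
    by (intro conjI exI[of _ "\<lambda>n x. \<phi> n x - \<psi> n x"]) (auto simp: gd)
qed

section \<open>Testing the equation\<close>

text \<open>The values of the approximations are needed pointwise, for dominated convergence and for
  Fatou's lemma, whereas their gradients are needed only in \<open>L\<^sup>2\<close>. Passing to a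
  subsequence gives the former and preserves the latter.\<close>

lemma test_approx_AE:
  fixes w :: "real ^ 'n \<Rightarrow> real"
  assumes "test_approx U w W" "U \<in> lmeasurable"
  obtains \<phi> where "\<And>n. \<phi> n \<in> test_functions U"
    "AE x in lebesgue_on U. (\<lambda>n. \<phi> n x) \<longlonglongrightarrow> w x"
    "(\<lambda>n. Lp_norm 2 U (\<lambda>x. W x - grad (\<phi> n) x)) \<longlonglongrightarrow> 0"
proof -
  obtain \<phi> where \<phi>: "\<And>n. \<phi> n \<in> test_functions U"
    and L: "(\<lambda>n. \<integral>x. (norm (w x - \<phi> n x))\<^sup>2 \<partial>lebesgue_on U) \<longlonglongrightarrow> 0"
      "(\<lambda>n. \<integral>x. (norm (W x - grad (\<phi> n) x))\<^sup>2 \<partial>lebesgue_on U) \<longlonglongrightarrow> 0"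
    using assms(1) unfolding test_approx_def by blast
  have i: "integrable (lebesgue_on U) (\<lambda>x. (norm (w x - \<phi> n x))\<^sup>2)" for n
    using in_L2_diff[of U w "\<phi> n"] in_L2_test_function(1)[OF \<phi> assms(2)] assms(1)
    by (auto simp: test_approx_def in_L2_iff)
  have "\<exists>r. strict_mono r \<and> (AE x in lebesgue_on U. (\<lambda>n. (norm (w x - \<phi> (r n) x))\<^sup>2) \<longlonglongrightarrow> 0)"
    by (rule tendsto_L1_AE_subseq[OF i]) (use L(1) in simp)
  then obtain r :: "nat \<Rightarrow> nat" where r: "strict_mono r"
    "AE x in lebesgue_on U. (\<lambda>n. (norm (w x - \<phi> (r n) x))\<^sup>2) \<longlonglongrightarrow> 0"
    by blast
  have "AE x in lebesgue_on U. (\<lambda>n. \<phi> (r n) x) \<longlonglongrightarrow> w x"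
    using r(2)
  proof eventually_elim
    case (elim x)
    from tendsto_real_sqrt[OF this] have "(\<lambda>n. norm (w x - \<phi> (r n) x)) \<longlonglongrightarrow> 0" by simp
    then have "(\<lambda>n. w x - \<phi> (r n) x) \<longlonglongrightarrow> 0" by (rule tendsto_norm_zero_cancel)
    from tendsto_diff[OF tendsto_const[of "w x"] this] show ?case by simp
  qed
  moreover have "(\<lambda>n. Lp_norm 2 U (\<lambda>x. W x - grad (\<phi> (r n)) x)) \<longlonglongrightarrow> 0"
    using tendsto_real_sqrt[OF LIMSEQ_subseq_LIMSEQ[OF L(2) r(1)]] by (simp add: Lp_norm_2 o_def)
  ultimately show ?thesis using that[of "\<lambda>n. \<phi> (r n)"] \<phi> by blast
qed

lemma test_approx_scale:
  assumes "test_approx U w W"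
  shows "test_approx U (\<lambda>x. a * w x) (\<lambda>x. a *\<^sub>R W x)"
proof -
  obtain \<phi> where \<phi>: "\<And>n. \<phi> n \<in> test_functions U"
    and L: "(\<lambda>n. \<integral>x. (norm (w x - \<phi> n x))\<^sup>2 \<partial>lebesgue_on U) \<longlonglongrightarrow> 0"
      "(\<lambda>n. \<integral>x. (norm (W x - grad (\<phi> n) x))\<^sup>2 \<partial>lebesgue_on U) \<longlonglongrightarrow> 0"
    using assms unfolding test_approx_def by blast
  have gd: "grad (\<lambda>x. a * \<phi> n x) x = a *\<^sub>R grad (\<phi> n) x" for n x
    by (rule grad_chain[OF test_functions_differentiable[OF \<phi>]]) (auto intro!: derivative_eq_intros)
  have "(norm (a * w x - a * \<phi> n x))\<^sup>2 = a\<^sup>2 * (norm (w x - \<phi> n x))\<^sup>2" for n x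
    by (simp add: power_mult_distrib flip: right_diff_distrib)
  then have 1: "(\<lambda>n. \<integral>x. (norm (a * w x - a * \<phi> n x))\<^sup>2 \<partial>lebesgue_on U) \<longlonglongrightarrow> 0"
    using tendsto_mult_left[OF L(1), of "a\<^sup>2"] by (simp only: integral_mult_right_zero mult_zero_right)
  have "(norm (a *\<^sub>R W x - grad (\<lambda>x. a * \<phi> n x) x))\<^sup>2 = a\<^sup>2 * (norm (W x - grad (\<phi> n) x))\<^sup>2" for n x
    by (simp add: gd power_mult_distrib flip: scaleR_diff_right)
  then have 2: "(\<lambda>n. \<integral>x. (norm (a *\<^sub>R W x - grad (\<lambda>x. a * \<phi> n x) x))\<^sup>2 \<partial>lebesgue_on U) \<longlonglongrightarrow> 0"
    using tendsto_mult_left[OF L(2), of "a\<^sup>2"] by (simp only: integral_mult_right_zero mult_zero_right)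
  have "in_Lp 2 U (\<lambda>x. a * w x)" "in_Lp 2 U (\<lambda>x. a *\<^sub>R W x)"
    using assms by (auto simp: test_approx_def in_L2_iff power_mult_distrib)
  then show ?thesis
    unfolding test_approx_def using 1 2 test_functions_scale[OF \<phi>, of a]
    by (intro conjI exI[of _ "\<lambda>n x. a * \<phi> n x"]) auto
qed

lemma in_L2_matrix_vector_mult:
  fixes A :: "real ^ 'n \<Rightarrow> real ^ 'n ^ 'm" and W :: "real ^ 'n \<Rightarrow> real ^ 'n"
  assumes "\<And>i j. (\<lambda>x. A x $ i $ j) \<in> borel_measurable (lebesgue_on U)"
    and "\<And>x i j. x \<in> U \<Longrightarrow> \<bar>A x $ i $ j\<bar> \<le> L" "in_Lp 2 U W" "U \<in> sets lebesgue"
  shows "in_Lp 2 U (\<lambda>x. A x *v W x)"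
  unfolding in_L2_iff
proof
  have Wm: "W \<in> borel_measurable (lebesgue_on U)" using assms by (simp add: in_L2_iff)
  have "(\<lambda>x. W x \<bullet> axis j 1) \<in> borel_measurable (lebesgue_on U)" for j
    using Wm by simp
  then have Wj: "(\<lambda>x. W x $ j) \<in> borel_measurable (lebesgue_on U)" for j by (simp add: inner_axis)
  have "(\<lambda>x. (A x *v W x) \<bullet> axis i 1) \<in> borel_measurable (lebesgue_on U)" for i
    using assms(1) Wj by (simp add: inner_axis matrix_vector_mult_def)
  then show m: "(\<lambda>x. A x *v W x) \<in> borel_measurable (lebesgue_on U)"
    by (subst borel_measurable_euclidean_space) (auto simp: Basis_vec_def)
  \<comment> \<open>Each component of \<open>A x *v W x\<close> is a sum of \<open>CARD('n)\<close>
    terms of size at most \<open>\<bar>L\<bar> * norm (W x)\<close>, and the norm is at most the sum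
    of the \<open>CARD('m)\<close> components in absolute value.\<close>
  define K where "K = real CARD('m) * (real CARD('n) * \<bar>L\<bar>)"
  have b: "norm (A x *v W x) \<le> K * norm (W x)" if "x \<in> U" for x
  proof -
    have "\<bar>(A x *v W x) $ i\<bar> \<le> real CARD('n) * \<bar>L\<bar> * norm (W x)" for i
    proof -
      have "\<bar>(A x *v W x) $ i\<bar> \<le> (\<Sum>j\<in>UNIV. \<bar>A x $ i $ j * W x $ j\<bar>)"
        by (simp add: matrix_vector_mult_def sum_abs)
      also have "\<dots> \<le> (\<Sum>j\<in>(UNIV::'n set). \<bar>L\<bar> * norm (W x))"
      proof (rule sum_mono)
        fix j
        have "\<bar>A x $ i $ j\<bar> \<le> \<bar>L\<bar>" using assms(2)[OF that, of i j] by linarith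
        then show "\<bar>A x $ i $ j * W x $ j\<bar> \<le> \<bar>L\<bar> * norm (W x)"
          unfolding abs_mult using component_le_norm_cart[of "W x" j] by (intro mult_mono) auto
      qed
      finally show ?thesis by simp
    qed
    then have "(\<Sum>i\<in>UNIV. \<bar>(A x *v W x) $ i\<bar>) \<le> (\<Sum>i\<in>(UNIV::'m set). real CARD('n) * \<bar>L\<bar> * norm (W x))"
      by (intro sum_mono)
    then show ?thesis
      using norm_le_l1_cart[of "A x *v W x"] by (simp add: K_def mult.assoc)
  qed
  show "integrable (lebesgue_on U) (\<lambda>x. (norm (A x *v W x))\<^sup>2)"
  proof (rule Bochner_Integration.integrable_bound)
    show "integrable (lebesgue_on U) (\<lambda>x. K\<^sup>2 * (norm (W x))\<^sup>2)"
      using assms by (simp add: in_L2_iff)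
    show "(\<lambda>x. (norm (A x *v W x))\<^sup>2) \<in> borel_measurable (lebesgue_on U)" using m by simp
    have "(norm (A x *v W x))\<^sup>2 \<le> K\<^sup>2 * (norm (W x))\<^sup>2" if "x \<in> U" for x
      using power_mono[OF b[OF that], of 2] by (simp add: power_mult_distrib)
    then show "AE x in lebesgue_on U. norm ((norm (A x *v W x))\<^sup>2) \<le> norm (K\<^sup>2 * (norm (W x))\<^sup>2)"
      by (intro AE_I2) simp
  qed
qed

lemma grad_mult_rs:
  assumes "\<phi> differentiable (at x)"
  shows "grad (\<lambda>x. \<phi> x * rs (\<phi> x)) x = rs (\<phi> x) ^ 3 *\<^sub>R grad \<phi> x"
  using grad_chain[OF assms DERIV_mult_rs] .

lemma grad_sqrt_minus_1:
  assumes "\<phi> differentiable (at x)"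
  shows "grad (\<lambda>x. (1 + (\<phi> x)\<^sup>2) * rs (\<phi> x) - 1) x = (\<phi> x * rs (\<phi> x)) *\<^sub>R grad \<phi> x"
  using grad_chain[OF assms DERIV_sqrt_minus_1] .

text \<open>Test with \<open>T \<phi>\<close>, \<open>T s = s * rs s\<close>, for \<open>\<phi>\<close> close to \<open>w\<close>. Ellipticity makes the second order
  term nonnegative up to the distance of \<open>grad \<phi>\<close> and \<open>W\<close>, and so does the sign of \<open>div B\<close> for
  the drift term, because \<open>T \<phi> *\<^sub>R grad \<phi>\<close> is the gradient of the nonnegative test function
  \<open>sqrt (1 + \<phi>\<^sup>2) - 1\<close>.\<close>

lemma weak_solution_tested:
  fixes U :: "(real ^ 'n) set"
  assumes A: "assumption_A p U lam A B c"
    and W: "in_Lp 2 U W" and w: "integrable (lebesgue_on U) (\<lambda>x. (c x + \<alpha>) * w x)"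
    and g: "integrable (lebesgue_on U) g"
    and eq: "\<And>\<phi>. \<phi> \<in> test_functions U \<Longrightarrow>
      (\<integral>x. (A x *v W x) \<bullet> grad \<phi> x + (B x \<bullet> W x + (c x + \<alpha>) * w x) * \<phi> x \<partial>lebesgue_on U)
      = (\<integral>x. g x * \<phi> x \<partial>lebesgue_on U)"
    and \<phi>: "\<phi> \<in> test_functions U"
  shows "(\<integral>x. (c x + \<alpha>) * w x * (\<phi> x * rs (\<phi> x)) \<partial>lebesgue_on U) \<le> (\<integral>x. \<bar>g x\<bar> \<partial>lebesgue_on U)
    + (Lp_norm 2 U (\<lambda>x. A x *v W x) + Lp_norm 2 U B) * Lp_norm 2 U (\<lambda>x. W x - grad \<phi> x)"
proof -
  define T where "T x = \<phi> x * rs (\<phi> x)" for x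
  have U: "U \<in> lmeasurable" "U \<in> sets lebesgue"
    using A by (auto simp: assumption_A_def lmeasurable_open borel_open)
  obtain L where "\<And>x i j. x \<in> U \<Longrightarrow> \<bar>A x $ i $ j\<bar> \<le> L"
    using A unfolding assumption_A_def by blast
  then have AW: "in_Lp 2 U (\<lambda>x. A x *v W x)"
    using A W U(2) by (intro in_L2_matrix_vector_mult[where L=L]) (auto simp: assumption_A_def)
  have B: "in_Lp 2 U B" using A by (simp add: assumption_A_def)
  have ell: "(A x *v W x) \<bullet> W x \<ge> 0" if "x \<in> U" for x
  proof -
    have "0 \<le> lam * (norm (W x))\<^sup>2" "lam * (norm (W x))\<^sup>2 \<le> (A x *v W x) \<bullet> W x"
      using A that by (auto simp: assumption_A_def)
    then show ?thesis by linarith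
  qed
  have diff: "\<phi> differentiable (at x)" for x by (rule test_functions_differentiable[OF \<phi>])
  have T: "T \<in> test_functions U" unfolding T_def[abs_def] by (rule test_functions_mult_rs[OF \<phi>])
  have gT: "grad T x = rs (\<phi> x) ^ 3 *\<^sub>R grad \<phi> x" for x
    unfolding T_def[abs_def] by (rule grad_mult_rs[OF diff])
  have Tm: "T \<in> borel_measurable (lebesgue_on U)" by (rule test_functions_measurable[OF T])
  have T1: "\<bar>T x\<bar> \<le> 1" for x by (simp add: T_def abs_mult_rs_le_1)
  have L2: "in_Lp 2 U (\<lambda>x. W x - grad \<phi> x)" "in_Lp 2 U (grad \<phi>)" "in_Lp 2 U (grad T)"
    using in_L2_diff[OF W] in_L2_test_function[OF \<phi> U(1)] in_L2_test_function[OF T U(1)] by auto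
  have i1: "integrable (lebesgue_on U) (\<lambda>x. (A x *v W x) \<bullet> grad T x)"
    by (rule in_L2_inner[OF AW L2(3)])
  have i2: "integrable (lebesgue_on U) (\<lambda>x. (B x \<bullet> W x) * T x)"
    by (rule integrable_mult_bounded[OF in_L2_inner[OF B W] Tm, of 1]) (simp add: T1)
  have i3: "integrable (lebesgue_on U) (\<lambda>x. (c x + \<alpha>) * w x * T x)"
    by (rule integrable_mult_bounded[OF w Tm, of 1]) (simp add: T1)
  have i4: "integrable (lebesgue_on U) (\<lambda>x. g x * T x)"
    by (rule integrable_mult_bounded[OF g Tm, of 1]) (simp add: T1)
  have i5: "integrable (lebesgue_on U) (\<lambda>x. (B x \<bullet> grad \<phi> x) * T x)"
    by (rule integrable_mult_bounded[OF in_L2_inner[OF B L2(2)] Tm, of 1]) (simp add: T1)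
  note i6 = in_L2_norm_mult[OF AW L2(1)]
  note i7 = in_L2_norm_mult[OF B L2(1)]
  have S: "(\<lambda>x. (1 + (\<phi> x)\<^sup>2) * rs (\<phi> x) - 1) \<in> test_functions U"
    by (rule test_functions_sqrt_minus_1[OF \<phi>])
  have "0 \<le> (\<integral>x. B x \<bullet> grad (\<lambda>x. (1 + (\<phi> x)\<^sup>2) * rs (\<phi> x) - 1) x \<partial>lebesgue_on U)"
  proof -
    have "weak_div_nonpos U B" using A by (simp add: assumption_A_def)
    then show ?thesis
      unfolding weak_div_nonpos_def by (rule bspec[OF _ S, THEN mp]) (intro ballI sqrt_minus_1_nonneg)
  qed
  then have div: "0 \<le> (\<integral>x. (B x \<bullet> grad \<phi> x) * T x \<partial>lebesgue_on U)"
    unfolding grad_sqrt_minus_1[OF diff] by (simp add: T_def mult.commute)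
  \<comment> \<open>The exchange of gradients goes in opposite directions. In the second order term
    \<open>grad \<phi> x\<close> becomes W minus the difference, since squaring W by ellipticity has
    a sign; in the drift term W becomes \<open>grad \<phi> x\<close> plus the difference, since the
    sign of div B is available for gradients of test functions.\<close>
  have pw: "(B x \<bullet> grad \<phi> x) * T x - norm (A x *v W x) * norm (W x - grad \<phi> x) - norm (B x) * norm (W x - grad \<phi> x)
      \<le> (A x *v W x) \<bullet> grad T x + (B x \<bullet> W x) * T x" if x: "x \<in> U" for x
  proof -
    let ?r = "rs (\<phi> x) ^ 3" and ?d = "W x - grad \<phi> x"
    have r: "0 \<le> ?r" "?r \<le> 1" using rs_pos[of "\<phi> x"] rs_le_1[of "\<phi> x"] by (auto simp: power_le_one less_imp_le)
    have "\<bar>?r * ((A x *v W x) \<bullet> ?d)\<bar> \<le> 1 * (norm (A x *v W x) * norm ?d)"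
      unfolding abs_mult using r Cauchy_Schwarz_ineq2[of "A x *v W x" ?d] by (intro mult_mono) auto
    moreover have "\<bar>T x * (B x \<bullet> ?d)\<bar> \<le> 1 * (norm (B x) * norm ?d)"
      unfolding abs_mult using T1[of x] Cauchy_Schwarz_ineq2[of "B x" ?d] by (intro mult_mono) auto
    moreover have "0 \<le> ?r * ((A x *v W x) \<bullet> W x)" using r(1) ell[OF x] by simp
    moreover have "(A x *v W x) \<bullet> grad T x = ?r * ((A x *v W x) \<bullet> W x) - ?r * ((A x *v W x) \<bullet> ?d)"
      by (simp add: gT inner_diff_right algebra_simps)
    moreover have "(B x \<bullet> W x) * T x = (B x \<bullet> grad \<phi> x) * T x + T x * (B x \<bullet> ?d)"
      by (simp add: inner_diff_right algebra_simps)
    ultimately show ?thesis by linarith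
  qed
  have "(\<integral>x. (B x \<bullet> grad \<phi> x) * T x \<partial>lebesgue_on U)
      - (\<integral>x. norm (A x *v W x) * norm (W x - grad \<phi> x) \<partial>lebesgue_on U)
      - (\<integral>x. norm (B x) * norm (W x - grad \<phi> x) \<partial>lebesgue_on U)
    \<le> (\<integral>x. (A x *v W x) \<bullet> grad T x \<partial>lebesgue_on U) + (\<integral>x. (B x \<bullet> W x) * T x \<partial>lebesgue_on U)"
  proof -
    have "(\<integral>x. (B x \<bullet> grad \<phi> x) * T x - norm (A x *v W x) * norm (W x - grad \<phi> x)
        - norm (B x) * norm (W x - grad \<phi> x) \<partial>lebesgue_on U)
      \<le> (\<integral>x. (A x *v W x) \<bullet> grad T x + (B x \<bullet> W x) * T x \<partial>lebesgue_on U)"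
      by (intro integral_mono Bochner_Integration.integrable_add Bochner_Integration.integrable_diff i1 i2 i5 i6(1) i7(1))
        (use pw in auto)
    then show ?thesis using i1 i2 i5 i6(1) i7(1) by simp
  qed
  moreover have "(\<integral>x. (A x *v W x) \<bullet> grad T x \<partial>lebesgue_on U) + (\<integral>x. (B x \<bullet> W x) * T x \<partial>lebesgue_on U)
      + (\<integral>x. (c x + \<alpha>) * w x * T x \<partial>lebesgue_on U) = (\<integral>x. g x * T x \<partial>lebesgue_on U)"
  proof -
    have "(\<integral>x. (A x *v W x) \<bullet> grad T x + (B x \<bullet> W x) * T x + (c x + \<alpha>) * w x * T x \<partial>lebesgue_on U)
      = (\<integral>x. g x * T x \<partial>lebesgue_on U)"
      using eq[OF T] by (simp only: distrib_right add.assoc)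
    then show ?thesis using i1 i2 i3 by simp
  qed
  moreover have "(\<integral>x. g x * T x \<partial>lebesgue_on U) \<le> (\<integral>x. \<bar>g x\<bar> \<partial>lebesgue_on U)"
  proof (rule integral_mono[OF i4])
    show "integrable (lebesgue_on U) (\<lambda>x. \<bar>g x\<bar>)" using g by simp
    show "g x * T x \<le> \<bar>g x\<bar>" for x
      using mult_left_mono[OF T1[of x], of "\<bar>g x\<bar>"] abs_mult[of "g x" "T x"] by auto
  qed
  ultimately show ?thesis
    using div i6(2) i7(2) unfolding T_def[symmetric] by (simp add: distrib_right)
qed

text \<open>In \<open>weak_solution_tested\<close> only the zero order term and the gradient error
  depend on \<phi>. Along an approximating sequence the error tends to zero, and the other term
  converges with the majorant \<bar>(c + \<alpha>) w\<bar>, because \<bar>T\<bar> \<le> 1.\<close>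

lemma weak_solution_mult_rs_bound:
  fixes U :: "(real ^ 'n) set"
  assumes A: "assumption_A p U lam A B c" and \<alpha>: "\<alpha> > 0"
    and w: "test_approx U w W" and cw: "integrable (lebesgue_on U) (\<lambda>x. c x * w x)"
    and g: "integrable (lebesgue_on U) g"
    and eq: "\<And>\<phi>. \<phi> \<in> test_functions U \<Longrightarrow>
      (\<integral>x. (A x *v W x) \<bullet> grad \<phi> x + (B x \<bullet> W x + (c x + \<alpha>) * w x) * \<phi> x \<partial>lebesgue_on U)
      = (\<integral>x. g x * \<phi> x \<partial>lebesgue_on U)"
  shows "\<alpha> * (\<integral>x. w x * (w x * rs (w x)) \<partial>lebesgue_on U) \<le> (\<integral>x. \<bar>g x\<bar> \<partial>lebesgue_on U)"
proof -
  have U: "U \<in> lmeasurable"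
    using A by (auto simp: assumption_A_def lmeasurable_open)
  have W2: "in_Lp 2 U W" and w2: "in_Lp 2 U w" using w by (auto simp: test_approx_def)
  have wm: "w \<in> borel_measurable (lebesgue_on U)" using w2 by (simp add: in_L2_iff)
  have "in_Lp 2 U (\<lambda>x::real^'n. 1::real)"
    by (rule in_L2_bounded[where M=1, OF U]) auto
  from in_L2_inner[OF w2 this] have w1: "integrable (lebesgue_on U) w" by simp
  then have caw: "integrable (lebesgue_on U) (\<lambda>x. (c x + \<alpha>) * w x)"
    using cw by (simp add: distrib_right)
  have "continuous_on UNIV rs" by (simp add: continuous_on_eq_continuous_at continuous_rs)
  then have [measurable]: "rs \<in> borel_measurable borel" by (rule borel_measurable_continuous_onI)
  have Tm: "(\<lambda>x. w x * rs (w x)) \<in> borel_measurable (lebesgue_on U)"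
    using wm by measurable
  obtain \<phi> where \<phi>: "\<And>n. \<phi> n \<in> test_functions U"
    "AE x in lebesgue_on U. (\<lambda>n. \<phi> n x) \<longlonglongrightarrow> w x"
    "(\<lambda>n. Lp_norm 2 U (\<lambda>x. W x - grad (\<phi> n) x)) \<longlonglongrightarrow> 0"
    by (rule test_approx_AE[OF w U]) (rule that)
  define K where "K = Lp_norm 2 U (\<lambda>x. A x *v W x) + Lp_norm 2 U B"
  have "(\<lambda>n. \<integral>x. (c x + \<alpha>) * w x * (\<phi> n x * rs (\<phi> n x)) \<partial>lebesgue_on U)
      \<longlonglongrightarrow> (\<integral>x. (c x + \<alpha>) * w x * (w x * rs (w x)) \<partial>lebesgue_on U)"
  proof (rule integral_dominated_convergence[where w="\<lambda>x. norm ((c x + \<alpha>) * w x)"])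
    show "integrable (lebesgue_on U) (\<lambda>x. norm ((c x + \<alpha>) * w x))" using caw by (rule integrable_norm)
    show "(\<lambda>x. (c x + \<alpha>) * w x * (w x * rs (w x))) \<in> borel_measurable (lebesgue_on U)"
      by (rule borel_measurable_times[OF borel_measurable_integrable[OF caw] Tm])
    show "(\<lambda>x. (c x + \<alpha>) * w x * (\<phi> n x * rs (\<phi> n x))) \<in> borel_measurable (lebesgue_on U)" for n
      by (rule borel_measurable_times[OF borel_measurable_integrable[OF caw]
        test_functions_measurable(1)[OF test_functions_mult_rs[OF \<phi>(1)]]])
    show "AE x in lebesgue_on U. (\<lambda>n. (c x + \<alpha>) * w x * (\<phi> n x * rs (\<phi> n x)))
        \<longlonglongrightarrow> (c x + \<alpha>) * w x * (w x * rs (w x))"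
      using \<phi>(2)
    proof eventually_elim
      case (elim x)
      then show ?case by (intro tendsto_mult tendsto_const isCont_tendsto_compose[OF continuous_rs])
    qed
    have "norm ((c x + \<alpha>) * w x * (\<phi> n x * rs (\<phi> n x))) \<le> norm ((c x + \<alpha>) * w x)" for n x
      unfolding norm_mult[of _ "\<phi> n x * rs (\<phi> n x)"] using abs_mult_rs_le_1[of "\<phi> n x"]
      by (intro mult_left_le) auto
    then show "AE x in lebesgue_on U. norm ((c x + \<alpha>) * w x * (\<phi> n x * rs (\<phi> n x))) \<le> norm ((c x + \<alpha>) * w x)" for n
      by simp
  qed
  moreover have "(\<lambda>n. (\<integral>x. \<bar>g x\<bar> \<partial>lebesgue_on U) + K * Lp_norm 2 U (\<lambda>x. W x - grad (\<phi> n) x))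
      \<longlonglongrightarrow> (\<integral>x. \<bar>g x\<bar> \<partial>lebesgue_on U) + K * 0"
    by (intro tendsto_intros \<phi>(3))
  moreover have "(\<integral>x. (c x + \<alpha>) * w x * (\<phi> n x * rs (\<phi> n x)) \<partial>lebesgue_on U)
      \<le> (\<integral>x. \<bar>g x\<bar> \<partial>lebesgue_on U) + K * Lp_norm 2 U (\<lambda>x. W x - grad (\<phi> n) x)" for n
    unfolding K_def by (rule weak_solution_tested[OF A W2 caw g eq \<phi>(1)])
  ultimately have "(\<integral>x. (c x + \<alpha>) * w x * (w x * rs (w x)) \<partial>lebesgue_on U) \<le> (\<integral>x. \<bar>g x\<bar> \<partial>lebesgue_on U) + K * 0"
    by (intro LIMSEQ_le) auto
  \<comment> \<open>Here c is dropped: c \<ge> 0 a.e., and w T(w) \<ge> 0 because T has the sign of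
    its argument.\<close>
  moreover have "(\<integral>x. \<alpha> * (w x * (w x * rs (w x))) \<partial>lebesgue_on U)
      \<le> (\<integral>x. (c x + \<alpha>) * w x * (w x * rs (w x)) \<partial>lebesgue_on U)"
  proof (rule integral_mono_AE)
    have b: "AE x in lebesgue_on U. \<bar>w x * rs (w x)\<bar> \<le> 1" by (simp add: abs_mult_rs_le_1)
    show "integrable (lebesgue_on U) (\<lambda>x. \<alpha> * (w x * (w x * rs (w x))))"
      using integrable_mult_bounded[OF w1 Tm b] by simp
    show "integrable (lebesgue_on U) (\<lambda>x. (c x + \<alpha>) * w x * (w x * rs (w x)))"
      by (rule integrable_mult_bounded[OF caw Tm b])
    have "AE x in lebesgue_on U. c x \<ge> 0" using A by (simp add: assumption_A_def)
    then show "AE x in lebesgue_on U. \<alpha> * (w x * (w x * rs (w x))) \<le> (c x + \<alpha>) * w x * (w x * rs (w x))"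
    proof eventually_elim
      case (elim x)
      have "w x * (w x * rs (w x)) = (w x)\<^sup>2 * rs (w x)" by (simp add: power2_eq_square)
      moreover have "0 \<le> (w x)\<^sup>2 * rs (w x)" using rs_pos[of "w x"] by simp
      ultimately have "0 \<le> w x * (w x * rs (w x))" by (simp only:)
      then have "\<alpha> * (w x * (w x * rs (w x))) \<le> (c x + \<alpha>) * (w x * (w x * rs (w x)))"
        using elim by (intro mult_right_mono) auto
      then show ?case by (simp only: mult.assoc)
    qed
  qed
  ultimately show ?thesis by simp
qed

section \<open>The estimate\<close>

text \<open>Applied to \<open>f = \<bar>c\<bar> sgn \<phi>\<close>, the energy estimate for \<open>- lam \<Delta>u = f\<close> yields by duality the
  instance of the Sobolev inequality that makes \<open>c * w\<close> integrable.\<close>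

lemma energy_constant_integral_coefficient_le:
  fixes U :: "(real ^ 'n) set"
  assumes C: "energy_constant p U lam C" and U: "bounded U" "open U" "CARD('n) \<ge> 2"
    and "lam > 0" "p > 0" and c: "in_Lp p U c" and \<phi>: "\<phi> \<in> test_functions U"
  shows "integrable (lebesgue_on U) (\<lambda>x. \<bar>c x * \<phi> x\<bar>)"
    "(\<integral>x. \<bar>c x * \<phi> x\<bar> \<partial>lebesgue_on U) \<le> lam * (C * Lp_norm p U c) * Lp_norm 2 U (grad \<phi>)"
proof -
  have Um: "U \<in> lmeasurable" using U by (simp add: lmeasurable_open)
  \<comment> \<open>The energy constant is tied to the ellipticity constant, so the identity matrix
    is scaled by lam; this factor reappears in the bound.\<close>
  define A :: "real ^ 'n \<Rightarrow> real ^ 'n ^ 'n" where "A x = mat lam" for x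
  define f where "f x = \<bar>c x\<bar> * sgn (\<phi> x)" for x
  have Av: "A x *v \<xi> = lam *\<^sub>R \<xi>" for x \<xi>
    by (simp add: A_def vec_eq_iff matrix_vector_mult_def mat_def if_distrib[of "\<lambda>t. t * _"] cong: if_cong)
  have Lam: "\<bar>A x $ i $ j\<bar> \<le> lam" for x i j using \<open>lam > 0\<close> by (simp add: A_def mat_def)
  have "assumption_A p U lam A (\<lambda>x. 0) (\<lambda>x. 0)"
    unfolding assumption_A_def
  proof (intro conjI)
    show "\<exists>Lam>0. \<forall>x\<in>U. \<forall>i j. \<bar>A x $ i $ j\<bar> \<le> Lam" using Lam \<open>lam > 0\<close> by blast
    show "\<forall>x\<in>U. \<forall>\<xi>. lam * (norm \<xi>)\<^sup>2 \<le> (A x *v \<xi>) \<bullet> \<xi>" by (simp add: Av power2_norm_eq_inner)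
  qed (use U \<open>lam > 0\<close> in \<open>simp_all add: A_def in_Lp_def weak_div_nonpos_def\<close>)
  moreover have cm: "c \<in> borel_measurable (lebesgue_on U)" using c by (simp add: in_Lp_def)
  have fm: "f \<in> borel_measurable (lebesgue_on U)"
    using cm test_functions_measurable(1)[OF \<phi>] unfolding f_def[abs_def] by measurable
  have fc': "\<bar>f x\<bar> \<le> \<bar>c x\<bar>" for x
    by (simp add: f_def abs_mult sgn_if)
  then have fc: "norm (f x) powr p \<le> norm (c x) powr p" for x
    using \<open>p > 0\<close> by (simp add: powr_mono2)
  have f: "in_Lp p U f"
    unfolding in_Lp_def
  proof
    show "integrable (lebesgue_on U) (\<lambda>x. norm (f x) powr p)"
      by (rule Bochner_Integration.integrable_bound[where f="\<lambda>x. norm (c x) powr p"])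
        (use c fm fc in \<open>auto simp: in_Lp_def\<close>)
  qed (rule fm)
  moreover have "in_Lp 2 U (\<lambda>x. 0 :: real ^ 'n)" by (simp add: in_Lp_def)
  ultimately obtain u where u: "is_weak_solution U A (\<lambda>x. 0) (\<lambda>x. 0) 0 f (\<lambda>x. 0) u"
    and nu: "H12_norm U u \<le> C * (Lp_norm p U f + Lp_norm 2 U (\<lambda>x. 0 :: real ^ 'n))"
    using C unfolding energy_constant_def by blast
  have "C > 0" using C by (simp add: energy_constant_def)
  have "Lp_norm p U f \<le> Lp_norm p U c"
    unfolding Lp_norm_def
    using f c fc' \<open>p > 0\<close> by (intro powr_mono2 integral_mono integral_nonneg_AE) (auto simp: in_Lp_def)
  then have nu': "H12_norm U u \<le> C * Lp_norm p U c"
    using nu \<open>C > 0\<close> by (auto simp: Lp_norm_2 elim!: order_trans)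
  note Du = H12_0_weak_grad[OF _ U(2), of u]
  have u0: "u \<in> H12_0 U" using u by (simp add: is_weak_solution_def)
  have "(Lp_norm 2 U (weak_grad U u))\<^sup>2 \<le> (H12_norm U u)\<^sup>2"
    unfolding H12_norm_sq[OF Du(2,3)[OF u0] U(2)] by (simp add: Lp_norm_2_sq)
  then have "Lp_norm 2 U (weak_grad U u) \<le> H12_norm U u"
    by (rule power2_le_imp_le) (simp add: H12_norm_def sum_nonneg)
  with nu' have nD: "Lp_norm 2 U (weak_grad U u) \<le> C * Lp_norm p U c" by linarith
  have f\<phi>: "f x * \<phi> x = \<bar>c x * \<phi> x\<bar>" for x by (simp add: f_def abs_mult sgn_if)
  \<comment> \<open>Integrability comes with the notion of weak solution. The equation then trades
    the integral of \<bar>c \<phi>\<bar> for an inner product of gradients, of which one is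
    controlled by the energy estimate.\<close>
  have "integrable (lebesgue_on U) (\<lambda>x. f x * \<phi> x)"
    and eq: "lam * (\<integral>x. weak_grad U u x \<bullet> grad \<phi> x \<partial>lebesgue_on U) = (\<integral>x. f x * \<phi> x \<partial>lebesgue_on U)"
    using u \<phi> by (simp_all add: is_weak_solution_def Let_def Av)
  then show "integrable (lebesgue_on U) (\<lambda>x. \<bar>c x * \<phi> x\<bar>)" by (simp add: f\<phi>)
  note L2 = Du(3)[OF u0] in_L2_test_function(2)[OF \<phi> Um]
  have "(\<integral>x. weak_grad U u x \<bullet> grad \<phi> x \<partial>lebesgue_on U)
      \<le> (\<integral>x. norm (weak_grad U u x) * norm (grad \<phi> x) \<partial>lebesgue_on U)"
    by (intro integral_mono in_L2_inner in_L2_norm_mult L2 norm_cauchy_schwarz)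
  also have "\<dots> \<le> Lp_norm 2 U (weak_grad U u) * Lp_norm 2 U (grad \<phi>)"
    by (rule in_L2_norm_mult(2)[OF L2])
  also have "\<dots> \<le> C * Lp_norm p U c * Lp_norm 2 U (grad \<phi>)"
    using nD by (intro mult_right_mono) (simp_all add: Lp_norm_2)
  finally have "lam * (\<integral>x. weak_grad U u x \<bullet> grad \<phi> x \<partial>lebesgue_on U)
      \<le> lam * (C * Lp_norm p U c * Lp_norm 2 U (grad \<phi>))"
    using \<open>lam > 0\<close> by (intro mult_left_mono) auto
  then show "(\<integral>x. \<bar>c x * \<phi> x\<bar> \<partial>lebesgue_on U) \<le> lam * (C * Lp_norm p U c) * Lp_norm 2 U (grad \<phi>)"
    unfolding eq f\<phi> by (simp only: mult.assoc)
qed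

text \<open>The gradients of the approximating test functions are bounded in
  \<open>L\<^sup>2\<close>, so the integrals of \<bar>c \<phi>\<bar> along the sequence have a
  common bound. Fatou's lemma carries it over to c w.\<close>

lemma integrable_coefficient_mult:
  fixes U :: "(real ^ 'n) set"
  assumes C: "energy_constant p U lam C" and U: "bounded U" "open U" "CARD('n) \<ge> 2"
    and "lam > 0" "p > 0" and c: "in_Lp p U c" and w: "test_approx U w W"
  shows "integrable (lebesgue_on U) (\<lambda>x. c x * w x)"
proof -
  have Um: "U \<in> lmeasurable" using U by (simp add: lmeasurable_open)
  obtain \<phi> where \<phi>: "\<And>n. \<phi> n \<in> test_functions U"
    "AE x in lebesgue_on U. (\<lambda>n. \<phi> n x) \<longlonglongrightarrow> w x"
    "(\<lambda>n. Lp_norm 2 U (\<lambda>x. W x - grad (\<phi> n) x)) \<longlonglongrightarrow> 0"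
    by (rule test_approx_AE[OF w Um]) (rule that)
  have m: "c \<in> borel_measurable (lebesgue_on U)" "w \<in> borel_measurable (lebesgue_on U)"
    using c w by (auto simp: in_Lp_def test_approx_def)
  have W: "in_Lp 2 U W" using w by (simp add: test_approx_def)
  note e = energy_constant_integral_coefficient_le[OF C U assms(5,6) c \<phi>(1)]
  obtain M where M: "\<And>n. Lp_norm 2 U (\<lambda>x. W x - grad (\<phi> n) x) \<le> M"
    using convergent_imp_Bseq[OF convergentI[OF \<phi>(3)]] unfolding Bseq_def real_norm_def
    by (meson abs_le_D1)
  \<comment> \<open>The factors 2 stem from |a - b|^2 \<le> 2 |a|^2 + 2 |b|^2, applied to the
    gradient written as W minus its distance from W.\<close>
  define N where "N = sqrt (2 * (Lp_norm 2 U W)\<^sup>2 + 2 * M\<^sup>2)"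
  have N: "Lp_norm 2 U (grad (\<phi> n)) \<le> N" for n
  proof -
    have "(Lp_norm 2 U (grad (\<phi> n)))\<^sup>2 = (\<integral>x. (norm (W x - (W x - grad (\<phi> n) x)))\<^sup>2 \<partial>lebesgue_on U)"
      by (simp add: Lp_norm_2_sq)
    also have "\<dots> \<le> 2 * (Lp_norm 2 U W)\<^sup>2 + 2 * (Lp_norm 2 U (\<lambda>x. W x - grad (\<phi> n) x))\<^sup>2"
      unfolding Lp_norm_2_sq
      by (intro integral_norm_diff_sq_le in_L2_diff W in_L2_test_function \<phi> Um)
    also have "\<dots> \<le> 2 * (Lp_norm 2 U W)\<^sup>2 + 2 * M\<^sup>2"
      using power_mono[OF M[of n], of 2] by (simp add: Lp_norm_2)
    finally show ?thesis unfolding N_def by (rule real_le_rsqrt)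
  qed
  have C0: "0 \<le> lam * (C * Lp_norm p U c)"
    using C \<open>lam > 0\<close> by (simp add: energy_constant_def Lp_norm_def)
  define K where "K = lam * (C * Lp_norm p U c) * N"
  have K: "(\<integral>x. \<bar>c x * \<phi> n x\<bar> \<partial>lebesgue_on U) \<le> K" for n
    using e(2)[of n] mult_left_mono[OF N[of n] C0] unfolding K_def by linarith
  show ?thesis
  proof (rule integrableI_bounded)
    show "(\<lambda>x. c x * w x) \<in> borel_measurable (lebesgue_on U)" using m by simp
    have "AE x in lebesgue_on U. ennreal (norm (c x * w x)) = liminf (\<lambda>n. ennreal \<bar>c x * \<phi> n x\<bar>)"
      using \<phi>(2)
    proof eventually_elim
      case (elim x)
      then have "(\<lambda>n. ennreal \<bar>c x * \<phi> n x\<bar>) \<longlonglongrightarrow> ennreal \<bar>c x * w x\<bar>"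
        by (intro tendsto_ennrealI tendsto_rabs tendsto_mult tendsto_const)
      from lim_imp_Liminf[OF _ this] show ?case by simp
    qed
    then have "(\<integral>\<^sup>+x. ennreal (norm (c x * w x)) \<partial>lebesgue_on U)
        = (\<integral>\<^sup>+x. liminf (\<lambda>n. ennreal \<bar>c x * \<phi> n x\<bar>) \<partial>lebesgue_on U)"
      by (rule nn_integral_cong_AE)
    also have "\<dots> \<le> liminf (\<lambda>n. \<integral>\<^sup>+x. ennreal \<bar>c x * \<phi> n x\<bar> \<partial>lebesgue_on U)"
      using m(1) test_functions_measurable(1)[OF \<phi>(1)] by (intro nn_integral_liminf) measurable
    also have "(\<lambda>n. \<integral>\<^sup>+x. ennreal \<bar>c x * \<phi> n x\<bar> \<partial>lebesgue_on U) = (\<lambda>n. ennreal (\<integral>x. \<bar>c x * \<phi> n x\<bar> \<partial>lebesgue_on U))"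
      using e(1) by (intro ext nn_integral_eq_integral) auto
    also have "liminf \<dots> \<le> liminf (\<lambda>n::nat. ennreal K)"
      using K by (intro Liminf_mono always_eventually allI ennreal_leI)
    also have "\<dots> < \<infinity>" by (simp add: Liminf_const)
    finally show "(\<integral>\<^sup>+x. ennreal (norm (c x * w x)) \<partial>lebesgue_on U) < \<infinity>" .
  qed
qed

section \<open>Integral norms of order one and removal of the smoothing\<close>

lemma Lp_norm_1: "Lp_norm 1 U f = (\<integral>x. norm (f x) \<partial>lebesgue_on U)"
  by (simp add: Lp_norm_def)

text \<open>Cauchy-Schwarz against the constant function 1; this is the origin of the factor
  \<open>measure lebesgue U powr (1/2)\<close> in the theorem.\<close>

lemma Lp_norm_1_le_Lp_norm_2:
  fixes f :: "real ^ 'n \<Rightarrow> real"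
  assumes "in_Lp 2 U f" "U \<in> lmeasurable"
  shows "integrable (lebesgue_on U) f" "Lp_norm 1 U f \<le> measure lebesgue U powr (1/2) * Lp_norm 2 U f"
proof -
  have 1: "in_Lp 2 U (\<lambda>x::real^'n. 1::real)"
    by (rule in_L2_bounded[where M=1, OF assms(2)]) auto
  have "Lp_norm 2 U (\<lambda>x::real^'n. 1::real) = measure lebesgue U powr (1/2)"
    using assms(2) by (simp add: Lp_norm_2 measure_restrict_space fmeasurableD powr_half_sqrt)
  then show "Lp_norm 1 U f \<le> measure lebesgue U powr (1/2) * Lp_norm 2 U f"
    using in_L2_norm_mult(2)[OF 1 assms(1)] by (simp add: Lp_norm_1)
  show "integrable (lebesgue_on U) f" using in_L2_inner[OF assms(1) 1] by simp
qed

text \<open>The equation is linear, so the smoothed bound holds for N w with data N g. Dividing by N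
  and letting N grow sharpens the smoothed modulus to the modulus.\<close>

lemma weak_solution_L1_bound:
  fixes U :: "(real ^ 'n) set"
  assumes A: "assumption_A p U lam A B c" and \<alpha>: "\<alpha> > 0"
    and w: "test_approx U w W" and cw: "integrable (lebesgue_on U) (\<lambda>x. c x * w x)"
    and g: "integrable (lebesgue_on U) g"
    and eq: "\<And>\<phi>. \<phi> \<in> test_functions U \<Longrightarrow>
      (\<integral>x. (A x *v W x) \<bullet> grad \<phi> x + (B x \<bullet> W x + (c x + \<alpha>) * w x) * \<phi> x \<partial>lebesgue_on U)
      = (\<integral>x. g x * \<phi> x \<partial>lebesgue_on U)"
  shows "\<alpha> * Lp_norm 1 U w \<le> Lp_norm 1 U g"
proof -
  have U: "U \<in> lmeasurable" using A by (auto simp: assumption_A_def lmeasurable_open)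
  have w2: "in_Lp 2 U w" using w by (simp add: test_approx_def)
  note w1 = Lp_norm_1_le_Lp_norm_2(1)[OF w2 U]
  \<comment> \<open>The last summand is the loss of at most 1 from \<open>mult_mult_rs_ge\<close>,
    integrated over U, multiplied by \<alpha> and divided by N.\<close>
  have scaled: "\<alpha> * Lp_norm 1 U w \<le> Lp_norm 1 U g + \<alpha> * measure lebesgue U * (1 / N)" if N: "N > 0" for N
  proof -
    have "\<alpha> * (\<integral>x. N * w x * (N * w x * rs (N * w x)) \<partial>lebesgue_on U) \<le> (\<integral>x. \<bar>N * g x\<bar> \<partial>lebesgue_on U)"
    proof (rule weak_solution_mult_rs_bound[OF A \<alpha> test_approx_scale[OF w]])
      show "integrable (lebesgue_on U) (\<lambda>x. c x * (N * w x))"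
        using integrable_mult_right[OF cw, of N] by (simp add: mult.left_commute)
      show "integrable (lebesgue_on U) (\<lambda>x. N * g x)" using g by simp
      fix \<phi> :: "real ^ 'n \<Rightarrow> real" assume "\<phi> \<in> test_functions U"
      have "(\<integral>x. (A x *v (N *\<^sub>R W x)) \<bullet> grad \<phi> x + (B x \<bullet> (N *\<^sub>R W x) + (c x + \<alpha>) * (N * w x)) * \<phi> x \<partial>lebesgue_on U)
        = (\<integral>x. N * ((A x *v W x) \<bullet> grad \<phi> x + (B x \<bullet> W x + (c x + \<alpha>) * w x) * \<phi> x) \<partial>lebesgue_on U)"
        by (intro Bochner_Integration.integral_cong refl)
          (simp add: matrix_vector_mult_scaleR distrib_left distrib_right mult_ac)
      also have "\<dots> = N * (\<integral>x. g x * \<phi> x \<partial>lebesgue_on U)"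
        using eq[OF \<open>\<phi> \<in> test_functions U\<close>] by (simp only: integral_mult_right_zero)
      finally show "(\<integral>x. (A x *v (N *\<^sub>R W x)) \<bullet> grad \<phi> x + (B x \<bullet> (N *\<^sub>R W x) + (c x + \<alpha>) * (N * w x)) * \<phi> x \<partial>lebesgue_on U)
        = (\<integral>x. N * g x * \<phi> x \<partial>lebesgue_on U)" by (simp add: mult.assoc)
    qed
    also have "\<dots> = N * Lp_norm 1 U g" using N by (simp add: abs_mult Lp_norm_1)
    finally have 1: "\<alpha> * (\<integral>x. N * w x * (N * w x * rs (N * w x)) \<partial>lebesgue_on U) \<le> N * Lp_norm 1 U g" .
    have "N * Lp_norm 1 U w - measure lebesgue U = (\<integral>x. \<bar>N * w x\<bar> - 1 \<partial>lebesgue_on U)"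
      using w1 N U finite_measure.integrable_const[OF finite_measure_lebesgue_on[OF U], of "1::real"]
      by (simp add: abs_mult Lp_norm_1 measure_restrict_space fmeasurableD)
    also have "\<dots> \<le> (\<integral>x. N * w x * (N * w x * rs (N * w x)) \<partial>lebesgue_on U)"
    proof (rule integral_mono)
      have "continuous_on UNIV rs" by (simp add: continuous_on_eq_continuous_at continuous_rs)
      then have [measurable]: "rs \<in> borel_measurable borel" by (rule borel_measurable_continuous_onI)
      have [measurable]: "w \<in> borel_measurable (lebesgue_on U)" using w1 by auto
      have "integrable (lebesgue_on U) (\<lambda>x. N * w x)" using w1 by simp
      then show "integrable (lebesgue_on U) (\<lambda>x. N * w x * (N * w x * rs (N * w x)))"
        by (rule integrable_mult_bounded[where C=1]) (measurable, simp add: abs_mult_rs_le_1)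
      show "integrable (lebesgue_on U) (\<lambda>x. \<bar>N * w x\<bar> - 1)"
        using w1 finite_measure.integrable_const[OF finite_measure_lebesgue_on[OF U], of "1::real"] by simp
      show "\<bar>N * w x\<bar> - 1 \<le> N * w x * (N * w x * rs (N * w x))" for x by (rule mult_mult_rs_ge)
    qed
    finally have "\<alpha> * (N * Lp_norm 1 U w - measure lebesgue U) \<le> N * Lp_norm 1 U g"
      using 1 \<alpha> by (meson mult_left_mono less_imp_le order_trans)
    then have "N * (\<alpha> * Lp_norm 1 U w) \<le> N * (Lp_norm 1 U g + \<alpha> * measure lebesgue U * (1 / N))"
      using N by (simp add: algebra_simps)
    then show ?thesis using N by (rule mult_left_le_imp_le)
  qed
  have "(\<lambda>n. Lp_norm 1 U g + \<alpha> * measure lebesgue U * (1 / real (Suc n))) \<longlonglongrightarrow> Lp_norm 1 U g + \<alpha> * measure lebesgue U * 0"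
    by (intro tendsto_intros LIMSEQ_Suc[OF lim_1_over_n])
  then have "\<alpha> * Lp_norm 1 U w \<le> Lp_norm 1 U g + \<alpha> * measure lebesgue U * 0"
    by (rule LIMSEQ_le_const) (use scaled in \<open>auto intro!: exI[of _ 0]\<close>)
  then show ?thesis by simp
qed

theorem theorem5p1:
  fixes U :: "(real ^ 'n) set"
    and A :: "real ^ 'n \<Rightarrow> real ^ 'n ^ 'n"
    and B G :: "real ^ 'n \<Rightarrow> real ^ 'n"
    and c g v :: "real ^ 'n \<Rightarrow> real"
    and p lam \<alpha> C\<^sub>1 :: real
  assumes "CARD('n) \<ge> 2"
    and "is_two_star CARD('n) p"
    and "bounded U" and "open U"
    and "assumption_A p U lam A B c"
    and "energy_constant p U lam C\<^sub>1"
    and "\<alpha> > 0"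
    and "in_Lp 1 U g" and "in_Lp 2 U G"
    and "v \<in> H12_0 U"
    and "is_weak_solution U A B c \<alpha> g G v"
  shows "Lp_norm 1 U v
           \<le> inverse \<alpha> * Lp_norm 1 U g + (measure lebesgue U) powr (1/2) * C\<^sub>1 * Lp_norm 2 U G"
proof -
  have U: "U \<in> lmeasurable" using assms(3,4) by (simp add: lmeasurable_open)
  have "p > 0" using assms(1,2) by (auto simp: is_two_star_def)
  have lam: "lam > 0" and c: "in_Lp p U c" using assms(5) by (auto simp: assumption_A_def)
  have g: "integrable (lebesgue_on U) g"
    using assms(8) integrable_norm_cancel[of "lebesgue_on U" g] by (simp add: in_Lp_def)
  have "in_Lp p U (\<lambda>x::real^'n. 0::real)" by (simp add: in_Lp_def)
  then obtain u where u: "is_weak_solution U A B c \<alpha> (\<lambda>x. 0) G u"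
    and nu: "H12_norm U u \<le> C\<^sub>1 * (Lp_norm p U (\<lambda>x::real^'n. 0::real) + Lp_norm 2 U G)"
    using assms(5,6,7,9) less_imp_le[OF assms(7)] unfolding energy_constant_def by blast
  have u0: "u \<in> H12_0 U" using u by (simp add: is_weak_solution_def)
  note Du = H12_0_weak_grad[OF u0 assms(4)]
  define W where "W x = weak_grad U v x - weak_grad U u x" for x
  have w: "test_approx U (\<lambda>x. v x - u x) W"
    unfolding W_def[abs_def]
    by (intro test_approx_diff H12_0_test_approx assms u0 U)
  have "\<alpha> * Lp_norm 1 U (\<lambda>x. v x - u x) \<le> Lp_norm 1 U g"
  proof (rule weak_solution_L1_bound[OF assms(5,7) w _ g])
    show "integrable (lebesgue_on U) (\<lambda>x. c x * (v x - u x))"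
      by (rule integrable_coefficient_mult[OF assms(6,3,4,1) lam \<open>p > 0\<close> c w])
    fix \<phi> :: "real ^ 'n \<Rightarrow> real" assume \<phi>: "\<phi> \<in> test_functions U"
    \<comment> \<open>The left-hand side is kept as one function: the notion of weak solution grants
      integrability of the whole sum. On the right, subtracting the inner product with G pointwise
      leaves g \<phi>.\<close>
    define L where "L z x = (A x *v weak_grad U z x) \<bullet> grad \<phi> x
      + (B x \<bullet> weak_grad U z x + (c x + \<alpha>) * z x) * \<phi> x" for z x
    have v: "integrable (lebesgue_on U) (L v)" "integrable (lebesgue_on U) (\<lambda>x. g x * \<phi> x + G x \<bullet> grad \<phi> x)"
      "(\<integral>x. L v x \<partial>lebesgue_on U) = (\<integral>x. g x * \<phi> x + G x \<bullet> grad \<phi> x \<partial>lebesgue_on U)"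
      using assms(11) \<phi> by (simp_all add: is_weak_solution_def Let_def L_def[abs_def])
    have u': "integrable (lebesgue_on U) (L u)" "integrable (lebesgue_on U) (\<lambda>x. G x \<bullet> grad \<phi> x)"
      "(\<integral>x. L u x \<partial>lebesgue_on U) = (\<integral>x. G x \<bullet> grad \<phi> x \<partial>lebesgue_on U)"
      using u \<phi> by (simp_all add: is_weak_solution_def Let_def L_def[abs_def])
    have "(\<integral>x. (A x *v W x) \<bullet> grad \<phi> x + (B x \<bullet> W x + (c x + \<alpha>) * (v x - u x)) * \<phi> x \<partial>lebesgue_on U)
      = (\<integral>x. L v x - L u x \<partial>lebesgue_on U)"
      by (intro Bochner_Integration.integral_cong refl)
        (simp add: L_def W_def matrix_vector_mult_diff_distrib inner_diff_left inner_diff_right algebra_simps)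
    also have "\<dots> = (\<integral>x. (g x * \<phi> x + G x \<bullet> grad \<phi> x) - G x \<bullet> grad \<phi> x \<partial>lebesgue_on U)"
      using v u' by (simp only: Bochner_Integration.integral_diff)
    finally show "(\<integral>x. (A x *v W x) \<bullet> grad \<phi> x + (B x \<bullet> W x + (c x + \<alpha>) * (v x - u x)) * \<phi> x \<partial>lebesgue_on U)
      = (\<integral>x. g x * \<phi> x \<partial>lebesgue_on U)" by simp
  qed
  then have wb: "Lp_norm 1 U (\<lambda>x. v x - u x) \<le> inverse \<alpha> * Lp_norm 1 U g"
    using assms(7) by (simp add: field_simps)
  have "(Lp_norm 2 U u)\<^sup>2 \<le> (H12_norm U u)\<^sup>2"
    unfolding H12_norm_sq[OF Du(2,3) assms(4)] by (simp add: Lp_norm_2_sq)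
  then have "Lp_norm 2 U u \<le> H12_norm U u"
    by (rule power2_le_imp_le) (simp add: H12_norm_def sum_nonneg)
  also have "\<dots> \<le> C\<^sub>1 * Lp_norm 2 U G" using nu by (simp add: Lp_norm_def)
  finally have "measure lebesgue U powr (1/2) * Lp_norm 2 U u \<le> measure lebesgue U powr (1/2) * (C\<^sub>1 * Lp_norm 2 U G)"
    by (intro mult_left_mono) auto
  then have ub: "Lp_norm 1 U u \<le> measure lebesgue U powr (1/2) * C\<^sub>1 * Lp_norm 2 U G"
    using Lp_norm_1_le_Lp_norm_2(2)[OF Du(1) U] by (simp add: mult.assoc)
  have i: "integrable (lebesgue_on U) u" "integrable (lebesgue_on U) v"
    using Lp_norm_1_le_Lp_norm_2(1)[OF _ U] Du(1) H12_0_weak_grad(1)[OF assms(10,4)] by auto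
  have "Lp_norm 1 U v \<le> (\<integral>x. norm (v x - u x) + norm (u x) \<partial>lebesgue_on U)"
    unfolding Lp_norm_1 using i by (intro integral_mono) (auto simp: norm_triangle_sub add.commute)
  also have "\<dots> = Lp_norm 1 U (\<lambda>x. v x - u x) + Lp_norm 1 U u"
    unfolding Lp_norm_1 using i by (intro Bochner_Integration.integral_add) auto
  finally show ?thesis using wb ub by linarith
qed

end
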